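(* For any small constant $\epsilon>0$, there is a sublinear-time algorithm that computes a $(2+\epsilon)$-approximate solution to the densest subgraph problem on an $n$-node undirected graph given in the incidence-list model. The algorithm makes $\tilde O(n)$ oracle queries, and requires $\tilde O(n)$ time and $\tilde O(n)$ space.
   Context: Incidence-list model: the input graph $G=(V,E)$, $|V|=n$, is accessed only via oracle queries of two kinds: a degree query returning the degree of a given node $v$, and a neighbor query returning the $i$-th element of the incidence list of neighbors of $v$. For nonempty $S\subseteq V$, $\rho(S)=|E(S)|/|S|$ where $E(S)$ is the set of edges with both endpoints in $S$; the densest subgraph value is $\rho^*(G)=\max_{S}\rho(S)$, and a $\gamma$-approximate solution is a value $\eta$ with $\rho^*(G)/\gamma\le\eta\le\rho^*(G)$. $\tilde O(\cdot)$ hides $\mathrm{poly}(\log n,1/\epsilon)$ factors. *)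

theory Defs
  imports "HOL-Probability.Probability" "HOL-Library.Log_Nat"
begin

section \<open>Graphs and densities\<close>

text \<open>Graphs have vertex set \<^term>\<open>{..<n}\<close> and are simple: no loops, no parallel edges.\<close>

definition simple_graph :: "nat \<Rightarrow> nat set set \<Rightarrow> bool" where
  "simple_graph n E \<longleftrightarrow> (\<forall>e\<in>E. e \<subseteq> {..<n} \<and> card e = 2)"

text \<open>The order of the neighbors inside each list is arbitrary (chosen by the adversary).\<close>

definition incidence_lists :: "nat \<Rightarrow> nat set set \<Rightarrow> (nat \<Rightarrow> nat list) \<Rightarrow> bool" where
  "incidence_lists n E inc \<longleftrightarrow>
     (\<forall>v<n. distinct (inc v) \<and> set (inc v) = {u. {v, u} \<in> E})"

definition density :: "nat set set \<Rightarrow> nat set \<Rightarrow> real" where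
  "density E S = real (card {e \<in> E. e \<subseteq> S}) / real (card S)"

definition densest_value :: "nat set \<Rightarrow> nat set set \<Rightarrow> real" where
  "densest_value V E = Max {density E S | S. S \<noteq> {} \<and> S \<subseteq> V}"

definition approx_solution :: "real \<Rightarrow> nat set \<Rightarrow> nat set set \<Rightarrow> real \<Rightarrow> bool" where
  "approx_solution \<gamma> V E \<eta> \<longleftrightarrow> densest_value V E / \<gamma> \<le> \<eta> \<and> \<eta> \<le> densest_value V E"


section \<open>A randomized random access machine with graph oracle\<close>

text \<open>
  The machine has finitely many registers (those named in the program) and an indirectly
  addressed memory; cells hold natural numbers. Costs are logarithmic: an instruction costs one
  plus the bit lengths of the numbers that it handles, so that arithmetic on huge numbers is not
  free. Random draws are uniform on an initial segment of the naturals.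
\<close>

datatype operand = Imm nat | Reg nat

datatype binop = Add | Sub | Mul | Div

datatype instr =
    Op nat binop operand operand
  | Load nat operand
  | Store operand operand
  | Random nat operand
  | Degree nat operand
  | Neighbor nat operand operand

datatype prog =
    Skip
  | Do instr
  | Seq prog prog
  | If operand prog prog
  | While operand prog

text \<open>
  The last three fields are bookkeeping that programs cannot read: time spent, number of oracle
  queries, and the largest space (in bits) occupied so far.
\<close>

record config =
  regs :: "nat \<Rightarrow> nat"
  mem :: "nat \<Rightarrow> nat"
  time :: nat
  queries :: nat
  peak :: nat

text \<open>
  Bits needed to list the nonzero cells together with their addresses. Only finitely many cells
  of a reachable configuration are nonzero, since all cells but one start at zero.
\<close>

definition cells_bits :: "(nat \<Rightarrow> nat) \<Rightarrow> nat" where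
  "cells_bits f = (\<Sum>a | f a \<noteq> 0. 1 + floorlog 2 a + floorlog 2 (f a))"

definition occupied :: "config \<Rightarrow> nat" where
  "occupied s = cells_bits (regs s) + cells_bits (mem s)"

definition charge :: "nat list \<Rightarrow> config \<Rightarrow> config" where
  "charge xs s = s\<lparr>time := time s + 1 + (\<Sum>x\<leftarrow>xs. floorlog 2 x),
                   peak := max (peak s) (occupied s)\<rparr>"

definition set_reg :: "nat \<Rightarrow> nat \<Rightarrow> config \<Rightarrow> config" where
  "set_reg r x s = s\<lparr>regs := (regs s)(r := x)\<rparr>"

definition set_mem :: "nat \<Rightarrow> nat \<Rightarrow> config \<Rightarrow> config" where
  "set_mem a x s = s\<lparr>mem := (mem s)(a := x)\<rparr>"

definition count_query :: "config \<Rightarrow> config" where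
  "count_query s = s\<lparr>queries := queries s + 1\<rparr>"

fun opval :: "operand \<Rightarrow> config \<Rightarrow> nat" where
  "opval (Imm k) s = k"
| "opval (Reg r) s = regs s r"

text \<open>Subtraction is truncated, division rounds down and division by zero yields zero.\<close>

fun binop_fun :: "binop \<Rightarrow> nat \<Rightarrow> nat \<Rightarrow> nat" where
  "binop_fun Add x y = x + y"
| "binop_fun Sub x y = x - y"
| "binop_fun Mul x y = x * y"
| "binop_fun Div x y = x div y"

text \<open>
  Neighbors are indexed from 0. A degree query about a non-vertex is answered by 0, and a neighbor
  query for a nonexistent list entry is answered by the non-vertex \<open>n\<close>.
\<close>

definition degree_answer :: "nat \<Rightarrow> (nat \<Rightarrow> nat list) \<Rightarrow> nat \<Rightarrow> nat" where
  "degree_answer n inc v = (if v < n then length (inc v) else 0)"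

definition neighbor_answer :: "nat \<Rightarrow> (nat \<Rightarrow> nat list) \<Rightarrow> nat \<Rightarrow> nat \<Rightarrow> nat" where
  "neighbor_answer n inc v i = (if v < n \<and> i < length (inc v) then inc v ! i else n)"

fun exec_instr :: "nat \<Rightarrow> (nat \<Rightarrow> nat list) \<Rightarrow> instr \<Rightarrow> config \<Rightarrow> config pmf" where
  "exec_instr n inc (Op r f x y) s =
     (let a = opval x s; b = opval y s; c = binop_fun f a b
      in return_pmf (charge [a, b, c] (set_reg r c s)))"
| "exec_instr n inc (Load r x) s =
     (let a = opval x s; b = mem s a
      in return_pmf (charge [a, b] (set_reg r b s)))"
| "exec_instr n inc (Store x y) s =
     (let a = opval x s; b = opval y s
      in return_pmf (charge [a, b] (set_mem a b s)))"
| "exec_instr n inc (Random r x) s =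
     (let a = opval x s
      in map_pmf (\<lambda>b. charge [a, b] (set_reg r b s)) (pmf_of_set {..a}))"
| "exec_instr n inc (Degree r x) s =
     (let a = opval x s; b = degree_answer n inc a
      in return_pmf (charge [a, b] (count_query (set_reg r b s))))"
| "exec_instr n inc (Neighbor r x y) s =
     (let a = opval x s; b = opval y s; c = neighbor_answer n inc a b
      in return_pmf (charge [a, b, c] (count_query (set_reg r c s))))"

text \<open>A test succeeds on nonzero values. Nonterminating runs are the missing mass of the result.\<close>

partial_function (spmf) loop :: "operand \<Rightarrow> (config \<Rightarrow> config spmf) \<Rightarrow> config \<Rightarrow> config spmf" where
  "loop x body s =
     (if opval x s \<noteq> 0 then bind_spmf (body (charge [opval x s] s)) (loop x body)
      else return_spmf (charge [opval x s] s))"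

primrec exec :: "nat \<Rightarrow> (nat \<Rightarrow> nat list) \<Rightarrow> prog \<Rightarrow> config \<Rightarrow> config spmf" where
  "exec n inc Skip = return_spmf"
| "exec n inc (Do i) = (\<lambda>s. spmf_of_pmf (exec_instr n inc i s))"
| "exec n inc (Seq p q) = (\<lambda>s. bind_spmf (exec n inc p s) (exec n inc q))"
| "exec n inc (If x p q) =
     (\<lambda>s. (if opval x s \<noteq> 0 then exec n inc p else exec n inc q) (charge [opval x s] s))"
| "exec n inc (While x p) = loop x (exec n inc p)"

text \<open>
  Initially register 0 holds the number of vertices and everything else is zero. The result is the
  fraction whose numerator and denominator are left in registers 0 and 1.
\<close>

definition init_config :: "nat \<Rightarrow> config" where
  "init_config n = charge [] \<lparr>regs = (\<lambda>_. 0)(0 := n), mem = (\<lambda>_. 0), time = 0, queries = 0, peak = 0\<rparr>"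

definition run :: "nat \<Rightarrow> (nat \<Rightarrow> nat list) \<Rightarrow> prog \<Rightarrow> config spmf" where
  "run n inc p = exec n inc p (init_config n)"

definition output_approx_solution :: "real \<Rightarrow> nat \<Rightarrow> nat set set \<Rightarrow> config \<Rightarrow> bool" where
  "output_approx_solution \<gamma> n E s \<longleftrightarrow>
     regs s 1 \<noteq> 0 \<and> approx_solution \<gamma> {..<n} E (real (regs s 0) / real (regs s 1))"

text \<open>
  For \<open>0 < \<epsilon> < 1\<close> and \<open>n \<ge> 1\<close> both \<open>log 2 (n + 1)\<close> and \<open>1 / \<epsilon>\<close> are at least 1, so every
  polynomial in \<open>log n\<close> and \<open>1 / \<epsilon>\<close> is below \<open>C * (log 2 (n + 1) / \<epsilon>) ^ k\<close> for some \<open>C\<close> and \<open>k\<close>.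
\<close>

definition near_linear :: "real \<Rightarrow> nat \<Rightarrow> real \<Rightarrow> nat \<Rightarrow> real" where
  "near_linear C k \<epsilon> n = C * real n * (log 2 (real n + 1) / \<epsilon>) ^ k"

end

theory Submission
  imports Defs
begin

text \<open>
  Start with all vertices and repeatedly delete those whose degree within the remaining set \<open>S\<close>
  is at most \<open>2 (1 + \<delta>)\<close> times the density of \<open>S\<close>. By Markov's inequality \<open>S\<close> shrinks by a
  factor \<open>1 + \<delta>\<close> in each pass, so there are \<open>O(log n / \<delta>)\<close> passes. In an optimal set all inner
  degrees are at least \<open>\<rho>\<close>, so when one of its vertices is first deleted, \<open>S\<close> has density at least
  \<open>\<rho> / (2 (1 + \<delta>))\<close>; hence the best density seen is a \<open>2 (1 + \<delta>)\<close>-approximation.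

  Inner degrees are only estimated, with fresh randomness in every pass: each incidence list is cut
  into blocks of \<open>B\<close> entries, one entry per block is queried, and the number of hits in \<open>S\<close> is
  scaled by \<open>B\<close>. With \<open>B\<close> proportional to the number of edges over \<open>n log n\<close> this costs
  \<open>O(n log n)\<close> queries, while \<open>\<rho> / B\<close> is at least of order \<open>log n\<close> because \<open>\<rho>\<close> is at least
  the number of edges over \<open>n\<close>. So a Chernoff bound gives errors of order \<open>\<delta> \<rho>\<close> for all vertices and passes.
\<close>

section \<open>A weakest preexpectation calculus for the machine\<close>

text \<open>The deletion test compares each count with the average count of the pass, not with the
  unknown density. Markov's inequality then applies to the counts themselves, whatever the samples
  were, so termination and all resource bounds hold on every run; only the quality of the output is
  probabilistic. The obstacle is dependence: the set \<open>S\<close> of a later pass is a function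
  of earlier samples. Each triple therefore starts from one fixed register and memory state, where
  \<open>S\<close> is fixed and all further draws are new, and the union bound arises by adding
  failure budgets along the run. List orders are adversarial, but one uniform position per block
  suffices: \<open>1 + x <= exp x\<close> bounds the moment of each block by its mean alone, and the
  product over the blocks depends only on the degree. With \<open>\<delta> = 1 / q\<close> all
  comparisons are made between natural numbers by cross multiplication. Estimates can exceed the
  truth, so the output is scaled down by \<open>q / (q + 2)\<close> to stay below
  \<open>\<rho>\<close>; all these losses are absorbed by taking \<open>q\<close> of order
  \<open>1 / \<epsilon>\<close>.\<close>

lemma nn_integral_bind_spmf:
  "(\<integral>\<^sup>+x. F x \<partial>measure_spmf (bind_spmf p f)) = (\<integral>\<^sup>+x. \<integral>\<^sup>+y. F y \<partial>measure_spmf (f x) \<partial>measure_spmf p)"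
  unfolding measure_spmf_bind
  by (subst nn_integral_bind[where B="count_space UNIV"]) (auto simp: o_def)

lemma nn_integral_measure_spmf_mono:
  assumes "\<And>x. x \<in> set_spmf p \<Longrightarrow> F x \<le> G x"
  shows "(\<integral>\<^sup>+x. F x \<partial>measure_spmf p) \<le> (\<integral>\<^sup>+x. G x \<partial>measure_spmf p)"
  using assms by (intro nn_integral_mono_AE) simp

lemma nn_integral_measure_spmf_add:
  "(\<integral>\<^sup>+x. F x + G x \<partial>measure_spmf p) = (\<integral>\<^sup>+x. F x \<partial>measure_spmf p) + (\<integral>\<^sup>+x. G x \<partial>measure_spmf p)"
  by (rule nn_integral_add) auto

lemma nn_integral_return_spmf: "(\<integral>\<^sup>+x. F x \<partial>measure_spmf (return_spmf x)) = F x"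
  by (simp add: measure_spmf_return_spmf nn_integral_return)

lemma nn_integral_measure_spmf_const_le: "(\<integral>\<^sup>+x. c \<partial>measure_spmf p) \<le> c"
  using measure_spmf.emeasure_space_le_1[of p]
  by (simp add: mult_left_le)

abbreviation block :: "prog list \<Rightarrow> prog" where
  "block ps \<equiv> foldr Seq ps Skip"

primrec val :: "operand \<Rightarrow> (nat \<Rightarrow> nat) \<Rightarrow> nat" where
  "val (Imm k) R = k"
| "val (Reg r) R = R r"

primrec imm_le :: "nat \<Rightarrow> operand \<Rightarrow> bool" where
  "imm_le M (Imm k) \<longleftrightarrow> k \<le> M"
| "imm_le M (Reg r) \<longleftrightarrow> True"

lemma opval_eq_val: "opval x s = val x (regs s)"
  by (cases x) auto

lemma config_charge [simp]:
  "regs (charge xs s) = regs s" "mem (charge xs s) = mem s" "queries (charge xs s) = queries s"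
  "time (charge xs s) = time s + 1 + (\<Sum>x\<leftarrow>xs. floorlog 2 x)"
  "peak (charge xs s) = max (peak s) (occupied s)"
  by (auto simp: charge_def)

lemma config_set_reg [simp]:
  "regs (set_reg r x s) = (regs s)(r := x)" "mem (set_reg r x s) = mem s"
  "queries (set_reg r x s) = queries s" "time (set_reg r x s) = time s" "peak (set_reg r x s) = peak s"
  by (auto simp: set_reg_def)

lemma config_set_mem [simp]:
  "regs (set_mem r x s) = regs s" "mem (set_mem r x s) = (mem s)(r := x)"
  "queries (set_mem r x s) = queries s" "time (set_mem r x s) = time s" "peak (set_mem r x s) = peak s"
  by (auto simp: set_mem_def)

lemma config_count_query [simp]:
  "regs (count_query s) = regs s" "mem (count_query s) = mem s"
  "queries (count_query s) = queries s + 1" "time (count_query s) = time s" "peak (count_query s) = peak s"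
  by (auto simp: count_query_def)

lemma cells_bits_le:
  assumes "\<And>a. a \<ge> N \<Longrightarrow> f a = 0" "\<And>a. f a \<le> M" "N \<le> M"
  shows "cells_bits f \<le> N * (1 + 2 * floorlog 2 M)"
proof -
  have sub: "{a. f a \<noteq> 0} \<subseteq> {..<N}"
    using assms(1) not_less by blast
  have "cells_bits f \<le> (\<Sum>a | f a \<noteq> 0. 1 + 2 * floorlog 2 M)"
    unfolding cells_bits_def
  proof (rule sum_mono)
    fix a assume "a \<in> {a. f a \<noteq> 0}"
    then have "a \<le> M" using sub assms(3) by auto
    then show "1 + floorlog 2 a + floorlog 2 (f a) \<le> 1 + 2 * floorlog 2 M"
      using floorlog_mono[of a M 2] floorlog_mono[of "f a" M 2] assms(2)[of a] by simp
  qed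
  also have "\<dots> = card {a. f a \<noteq> 0} * (1 + 2 * floorlog 2 M)"
    by (simp only: sum_constant of_nat_id)
  also have "\<dots> \<le> N * (1 + 2 * floorlog 2 M)"
    using card_mono[OF _ sub] by (intro mult_le_mono1) simp
  finally show ?thesis .
qed

text \<open>\<open>K\<close> and \<open>A\<close> limit the registers and memory cells that may be
  nonzero, \<open>M\<close> limits every number held. With \<open>K\<close> and \<open>A\<close> at
  most \<open>M\<close>, addresses are short as well, so space is bounded once values are.\<close>

locale ram =
  fixes n :: nat and inc :: "nat \<Rightarrow> nat list" and K A M :: nat
  assumes K_le: "K \<le> M" and A_le: "A \<le> M" and n_le: "n \<le> M"
    and degree_le: "v < n \<Longrightarrow> length (inc v) \<le> n"
    and neighbor_le: "v < n \<Longrightarrow> u \<in> set (inc v) \<Longrightarrow> u \<le> n"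
begin

text \<open>
  All cells stay at most \<open>M\<close>, so every charge costs at most \<open>1 + 3 * floorlog 2 M\<close> and it suffices
  to count charges.
\<close>

definition charged :: "nat \<Rightarrow> config \<Rightarrow> bool" where
  "charged k s \<longleftrightarrow> time s \<le> k * (1 + 3 * floorlog 2 M) \<and> queries s \<le> k \<and>
     peak s \<le> (K + A) * (1 + 2 * floorlog 2 M) \<and>
     (\<forall>r. regs s r \<le> M) \<and> (\<forall>r\<ge>K. regs s r = 0) \<and> (\<forall>a. mem s a \<le> M) \<and> (\<forall>a\<ge>A. mem s a = 0)"

lemma charged_val_le: "charged k s \<Longrightarrow> imm_le M x \<Longrightarrow> val x (regs s) \<le> M"
  by (cases x) (auto simp: charged_def)

text \<open>Each instruction or test makes one charge on at most three numbers and at most one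
  query, so the single counter \<open>k\<close> controls time and queries together. Space is
  controlled by the fixed range of nonzero cells.\<close>

lemma charged_step:
  assumes "charged k s"
    and "time s' = time s" "queries s' \<le> queries s + 1" "peak s' = peak s"
    and "\<And>r. regs s' r \<noteq> regs s r \<Longrightarrow> r < K \<and> regs s' r \<le> M"
    and "\<And>a. mem s' a \<noteq> mem s a \<Longrightarrow> a < A \<and> mem s' a \<le> M"
    and "length xs \<le> 3" "\<And>x. x \<in> set xs \<Longrightarrow> x \<le> M"
  shows "charged (Suc k) (charge xs s')"
proof -
  have r: "regs s' r \<le> M" "r \<ge> K \<Longrightarrow> regs s' r = 0" for r
    using assms(1) assms(5)[of r] unfolding charged_def by (cases "r < K"; fastforce)+
  have m: "mem s' r \<le> M" "r \<ge> A \<Longrightarrow> mem s' r = 0" for r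
    using assms(1) assms(6)[of r] unfolding charged_def by (cases "r < A"; fastforce)+
  have "(\<Sum>x\<leftarrow>xs. floorlog 2 x) \<le> (\<Sum>x\<leftarrow>xs. floorlog 2 M)"
    by (rule sum_list_mono) (simp add: assms(8) floorlog_mono)
  also have "\<dots> \<le> 3 * floorlog 2 M"
    using assms(7) by (simp add: sum_list_triv)
  finally have "(\<Sum>x\<leftarrow>xs. floorlog 2 x) \<le> 3 * floorlog 2 M" .
  moreover have "occupied s' \<le> (K + A) * (1 + 2 * floorlog 2 M)"
    using cells_bits_le[of K "regs s'" M] cells_bits_le[of A "mem s'" M] r m K_le A_le
    unfolding occupied_def by (simp add: add_mult_distrib)
  ultimately show ?thesis
    using assms(1-4) r m by (simp add: charged_def algebra_simps)
qed

text \<open>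
  \<open>triple p k R m Q F \<phi>\<close>: started with at most \<open>k\<close> charges from registers \<open>R\<close> and memory \<open>m\<close>,
  \<open>p\<close> almost surely terminates, always ends in \<open>Q\<close> (again with a bound on the charges), and the
  expectation of \<open>F\<close> at the end is at most \<open>\<phi>\<close>. A failure event is an \<open>F\<close> with values 0 and 1.
\<close>

definition triple :: "prog \<Rightarrow> nat \<Rightarrow> (nat \<Rightarrow> nat) \<Rightarrow> (nat \<Rightarrow> nat) \<Rightarrow>
    (nat \<Rightarrow> (nat \<Rightarrow> nat) \<Rightarrow> (nat \<Rightarrow> nat) \<Rightarrow> bool) \<Rightarrow> ((nat \<Rightarrow> nat) \<Rightarrow> (nat \<Rightarrow> nat) \<Rightarrow> ennreal) \<Rightarrow>
    ennreal \<Rightarrow> bool" where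
  "triple p k R m Q F \<phi> \<longleftrightarrow> (\<forall>s. charged k s \<and> regs s = R \<and> mem s = m \<longrightarrow>
     lossless_spmf (exec n inc p s) \<and>
     (\<forall>s'\<in>set_spmf (exec n inc p s). \<exists>k'. charged k' s' \<and> Q k' (regs s') (mem s')) \<and>
     (\<integral>\<^sup>+s'. F (regs s') (mem s') \<partial>measure_spmf (exec n inc p s)) \<le> \<phi>)"

lemma triple_mono:
  assumes "triple p k R m Q F \<phi>"
    and "\<And>k R m. Q k R m \<Longrightarrow> Q' k R m"
    and "\<And>k R m. Q k R m \<Longrightarrow> F' R m \<le> F R m"
    and "\<phi> \<le> \<phi>'"
  shows "triple p k R m Q' F' \<phi>'"
  unfolding triple_def
proof (intro allI impI, elim conjE)
  fix s assume s: "charged k s" "regs s = R" "mem s = m"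
  let ?M = "exec n inc p s"
  have *: "lossless_spmf ?M" "\<And>s'. s' \<in> set_spmf ?M \<Longrightarrow> \<exists>k'. charged k' s' \<and> Q k' (regs s') (mem s')"
    "(\<integral>\<^sup>+s'. F (regs s') (mem s') \<partial>measure_spmf ?M) \<le> \<phi>"
    using assms(1) s unfolding triple_def by auto
  have "(\<integral>\<^sup>+s'. F' (regs s') (mem s') \<partial>measure_spmf ?M) \<le> (\<integral>\<^sup>+s'. F (regs s') (mem s') \<partial>measure_spmf ?M)"
    by (rule nn_integral_measure_spmf_mono) (use *(2) assms(3) in blast)
  then show "lossless_spmf ?M \<and> (\<forall>s'\<in>set_spmf ?M. \<exists>k'. charged k' s' \<and> Q' k' (regs s') (mem s')) \<and>
     (\<integral>\<^sup>+s'. F' (regs s') (mem s') \<partial>measure_spmf ?M) \<le> \<phi>'"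
    using * assms(2,4) by (meson order_trans)
qed

lemma triple_add:
  assumes "triple p k R m Q F \<phi>" "triple p k R m Q G \<psi>"
  shows "triple p k R m Q (\<lambda>R m. F R m + G R m) (\<phi> + \<psi>)"
  using assms unfolding triple_def by (auto simp: nn_integral_measure_spmf_add intro!: add_mono)

lemma triple_zero:
  assumes "triple p k R m Q F \<phi>"
  shows "triple p k R m Q (\<lambda>_ _. 0) 0"
  using assms unfolding triple_def by auto

lemma triple_const:
  assumes "triple p k R m Q F \<phi>"
  shows "triple p k R m Q (\<lambda>R m. F R m + a) (\<phi> + a)"
proof (rule triple_add[OF assms])
  show "triple p k R m Q (\<lambda>R m. a) a"
    using assms unfolding triple_def by (auto simp del: nn_integral_const simp: nn_integral_measure_spmf_const_le)
qed

lemma triple_Skip: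
  assumes "Q k R m" "F R m \<le> \<phi>"
  shows "triple Skip k R m Q F \<phi>"
  using assms unfolding triple_def by (auto simp: nn_integral_return_spmf)

lemma triple_Seq:
  assumes "triple p k R m Q' F' \<phi>"
    and "\<And>k R m. Q' k R m \<Longrightarrow> triple q k R m Q F (F' R m)"
  shows "triple (Seq p q) k R m Q F \<phi>"
  unfolding triple_def
proof (intro allI impI, elim conjE)
  fix s assume s: "charged k s" "regs s = R" "mem s = m"
  let ?M = "exec n inc p s" and ?N = "exec n inc q"
  have *: "lossless_spmf ?M" "\<And>s'. s' \<in> set_spmf ?M \<Longrightarrow> \<exists>k'. charged k' s' \<and> Q' k' (regs s') (mem s')"
    "(\<integral>\<^sup>+s'. F' (regs s') (mem s') \<partial>measure_spmf ?M) \<le> \<phi>"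
    using assms(1) s unfolding triple_def by auto
  have **: "lossless_spmf (?N s') \<and> (\<forall>s\<in>set_spmf (?N s'). \<exists>k'. charged k' s \<and> Q k' (regs s) (mem s)) \<and>
     (\<integral>\<^sup>+s. F (regs s) (mem s) \<partial>measure_spmf (?N s')) \<le> F' (regs s') (mem s')"
    if "s' \<in> set_spmf ?M" for s'
    using *(2)[OF that] assms(2) unfolding triple_def by blast
  have "(\<integral>\<^sup>+s'. F (regs s') (mem s') \<partial>measure_spmf (exec n inc (Seq p q) s)) \<le>
      (\<integral>\<^sup>+s'. F' (regs s') (mem s') \<partial>measure_spmf ?M)"
    unfolding exec.simps nn_integral_bind_spmf
    by (rule nn_integral_measure_spmf_mono) (use ** in blast)
  then show "lossless_spmf (exec n inc (Seq p q) s) \<and>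
     (\<forall>s'\<in>set_spmf (exec n inc (Seq p q) s). \<exists>k'. charged k' s' \<and> Q k' (regs s') (mem s')) \<and>
     (\<integral>\<^sup>+s'. F (regs s') (mem s') \<partial>measure_spmf (exec n inc (Seq p q) s)) \<le> \<phi>"
    using * ** by (auto simp: set_bind_spmf)
qed

text \<open>Stated with the continuation \<open>q\<close>, so that straight-line code is executed
  symbolically from the front: registers and memory remain explicit function updates.\<close>

lemma triple_Do_Seq:
  assumes "\<And>s. charged k s \<Longrightarrow> regs s = R \<Longrightarrow> mem s = m \<Longrightarrow>
      \<exists>s'. exec_instr n inc i s = return_pmf s' \<and> charged (k + 1) s' \<and> regs s' = R' \<and> mem s' = m'"
    and "triple q (k + 1) R' m' Q F \<phi>"
  shows "triple (Seq (Do i) q) k R m Q F \<phi>"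
  unfolding triple_def
proof (intro allI impI, elim conjE)
  fix s assume s: "charged k s" "regs s = R" "mem s = m"
  then obtain s' where s': "exec_instr n inc i s = return_pmf s'" "charged (k + 1) s'" "regs s' = R'" "mem s' = m'"
    using assms(1) by blast
  then have "exec n inc (Seq (Do i) q) s = exec n inc q s'"
    by (simp add: bind_return_pmf)
  then show "lossless_spmf (exec n inc (Seq (Do i) q) s) \<and>
     (\<forall>s'\<in>set_spmf (exec n inc (Seq (Do i) q) s). \<exists>k'. charged k' s' \<and> Q k' (regs s') (mem s')) \<and>
     (\<integral>\<^sup>+s'. F (regs s') (mem s') \<partial>measure_spmf (exec n inc (Seq (Do i) q) s)) \<le> \<phi>"
    using assms(2) s'(2-4) unfolding triple_def by simp
qed

lemma triple_Op:
  assumes "imm_le M x" "imm_le M y" "r < K"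
    and "f \<in> {Add, Mul} \<Longrightarrow> binop_fun f (val x R) (val y R) \<le> M"
    and "triple q (k + 1) (R(r := binop_fun f (val x R) (val y R))) m Q F \<phi>"
  shows "triple (Seq (Do (Op r f x y)) q) k R m Q F \<phi>"
proof (rule triple_Do_Seq[OF _ assms(5)])
  show "\<exists>s'. exec_instr n inc (Op r f x y) s = return_pmf s' \<and> charged (k + 1) s' \<and>
      regs s' = R(r := binop_fun f (val x R) (val y R)) \<and> mem s' = m"
    if "charged k s" "regs s = R" "mem s = m" for s
  proof -
    have *: "val x R \<le> M" "val y R \<le> M"
      using charged_val_le[OF that(1) assms(1)] charged_val_le[OF that(1) assms(2)] that(2) by auto
    then have "binop_fun f (val x R) (val y R) \<le> M"
      using assms(4) by (cases f) (auto intro: le_trans[OF div_le_dividend])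
    then show ?thesis
      using assms(3) * that by (auto simp: Let_def opval_eq_val intro!: charged_step[of k s] split: if_splits)
  qed
qed

lemma triple_Load:
  assumes "imm_le M x" "r < K"
    and "triple q (k + 1) (R(r := m (val x R))) m Q F \<phi>"
  shows "triple (Seq (Do (Load r x)) q) k R m Q F \<phi>"
proof (rule triple_Do_Seq[OF _ assms(3)])
  show "\<exists>s'. exec_instr n inc (Load r x) s = return_pmf s' \<and> charged (k + 1) s' \<and>
      regs s' = R(r := m (val x R)) \<and> mem s' = m"
    if "charged k s" "regs s = R" "mem s = m" for s
  proof -
    have "m (val x R) \<le> M" using that by (auto simp: charged_def)
    then show ?thesis
      using assms(2) charged_val_le[OF that(1) assms(1)] that by (auto simp: Let_def opval_eq_val intro!: charged_step[of k s] split: if_splits)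
  qed
qed

lemma triple_Store:
  assumes "val x R < A" "imm_le M y"
    and "triple q (k + 1) R (m(val x R := val y R)) Q F \<phi>"
  shows "triple (Seq (Do (Store x y)) q) k R m Q F \<phi>"
proof (rule triple_Do_Seq[OF _ assms(3)])
  show "\<exists>s'. exec_instr n inc (Store x y) s = return_pmf s' \<and> charged (k + 1) s' \<and>
      regs s' = R \<and> mem s' = m(val x R := val y R)"
    if "charged k s" "regs s = R" "mem s = m" for s
    using assms(1) A_le charged_val_le[OF that(1) assms(2)] that by (auto simp: Let_def opval_eq_val intro!: charged_step[of k s] split: if_splits)
qed

lemma triple_Degree:
  assumes "imm_le M x" "r < K"
    and "triple q (k + 1) (R(r := degree_answer n inc (val x R))) m Q F \<phi>"
  shows "triple (Seq (Do (Degree r x)) q) k R m Q F \<phi>"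
proof (rule triple_Do_Seq[OF _ assms(3)])
  have "degree_answer n inc (val x R) \<le> M"
    using n_le degree_le by (auto simp: degree_answer_def intro: le_trans)
  then show "\<exists>s'. exec_instr n inc (Degree r x) s = return_pmf s' \<and> charged (k + 1) s' \<and>
      regs s' = R(r := degree_answer n inc (val x R)) \<and> mem s' = m"
    if "charged k s" "regs s = R" "mem s = m" for s
    using assms(2) charged_val_le[OF that(1) assms(1)] that by (auto simp: Let_def opval_eq_val intro!: charged_step[of k s] split: if_splits)
qed

lemma triple_Neighbor:
  assumes "imm_le M x" "imm_le M y" "r < K"
    and "triple q (k + 1) (R(r := neighbor_answer n inc (val x R) (val y R))) m Q F \<phi>"
  shows "triple (Seq (Do (Neighbor r x y)) q) k R m Q F \<phi>"
proof (rule triple_Do_Seq[OF _ assms(4)])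
  have "neighbor_answer n inc (val x R) (val y R) \<le> M"
    using n_le neighbor_le[OF _ nth_mem] by (auto simp: neighbor_answer_def intro: le_trans)
  then show "\<exists>s'. exec_instr n inc (Neighbor r x y) s = return_pmf s' \<and> charged (k + 1) s' \<and>
      regs s' = R(r := neighbor_answer n inc (val x R) (val y R)) \<and> mem s' = m"
    if "charged k s" "regs s = R" "mem s = m" for s
    using assms(3) charged_val_le[OF that(1) assms(1)] charged_val_le[OF that(1) assms(2)] that
    by (auto simp: Let_def opval_eq_val intro!: charged_step[of k s] split: if_splits)
qed

text \<open>The place where probability enters: each drawn value \<open>b\<close> has its own bound
  \<open>f b\<close>, and only the average of these bounds has to stay below
  \<open>g\<close>.\<close>

lemma triple_Random:
  fixes f :: "nat \<Rightarrow> real"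
  assumes "imm_le M x" "r < K"
    and "\<And>b. b \<le> val x R \<Longrightarrow> triple q (k + 1) (R(r := b)) m Q F (ennreal (f b))"
    and "\<And>b. f b \<ge> 0" and "(\<Sum>b\<le>val x R. f b) \<le> g * real (Suc (val x R))"
  shows "triple (Seq (Do (Random r x)) q) k R m Q F (ennreal g)"
proof (rule triple_Seq)
  let ?Q = "\<lambda>k' R' m'. \<exists>b\<le>val x R. k' = k + 1 \<and> R' = R(r := b) \<and> m' = m"
  show "triple (Do (Random r x)) k R m ?Q (\<lambda>R m. ennreal (f (R r))) (ennreal g)"
    unfolding triple_def
  proof (intro allI impI, elim conjE)
    fix s assume s: "charged k s" "regs s = R" "mem s = m"
    let ?M = "exec n inc (Do (Random r x)) s"
    have *: "?M = spmf_of_pmf (map_pmf (\<lambda>b. charge [val x R, b] (set_reg r b s)) (pmf_of_set {..val x R}))"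
      using s by (simp add: Let_def opval_eq_val)
    have "charged (k + 1) (charge [val x R, b] (set_reg r b s))" if "b \<le> val x R" for b
      using s assms(2) charged_val_le[OF s(1) assms(1)] that by (auto intro!: charged_step[of k s] split: if_splits)
    then have "\<forall>s'\<in>set_spmf ?M. \<exists>k'. charged k' s' \<and> ?Q k' (regs s') (mem s')"
      unfolding * using s by auto
    moreover have "(\<integral>\<^sup>+s'. ennreal (f (regs s' r)) \<partial>measure_spmf ?M) =
        (\<Sum>b\<le>val x R. ennreal (f b)) / ennreal (real (Suc (val x R)))"
      unfolding * by (simp add: nn_integral_pmf_of_set ennreal_of_nat_eq_real_of_nat del: of_nat_Suc)
    moreover have "\<dots> = ennreal ((\<Sum>b\<le>val x R. f b) / real (Suc (val x R)))"
      using assms(4) by (simp add: divide_ennreal sum_nonneg del: of_nat_Suc)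
    moreover have "\<dots> \<le> ennreal g"
      using assms(5) by (intro ennreal_leI) (simp add: divide_le_eq del: of_nat_Suc)
    ultimately show "lossless_spmf ?M \<and> (\<forall>s'\<in>set_spmf ?M. \<exists>k'. charged k' s' \<and> ?Q k' (regs s') (mem s')) \<and>
        (\<integral>\<^sup>+s'. ennreal (f (regs s' r)) \<partial>measure_spmf ?M) \<le> ennreal g"
      by simp
  qed
qed (use assms(3) in auto)

lemma triple_If:
  assumes "imm_le M x"
    and "val x R \<noteq> 0 \<Longrightarrow> triple (Seq p r) (k + 1) R m Q F \<phi>"
    and "val x R = 0 \<Longrightarrow> triple (Seq q r) (k + 1) R m Q F \<phi>"
  shows "triple (Seq (If x p q) r) k R m Q F \<phi>"
  unfolding triple_def
proof (intro allI impI, elim conjE)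
  fix s assume s: "charged k s" "regs s = R" "mem s = m"
  define s' where "s' = charge [val x R] s"
  have s': "charged (k + 1) s'" "regs s' = R" "mem s' = m"
    using s charged_val_le[OF s(1) assms(1)] unfolding s'_def by (auto intro!: charged_step[of k s])
  show "lossless_spmf (exec n inc (Seq (If x p q) r) s) \<and>
     (\<forall>s'\<in>set_spmf (exec n inc (Seq (If x p q) r) s). \<exists>k'. charged k' s' \<and> Q k' (regs s') (mem s')) \<and>
     (\<integral>\<^sup>+s'. F (regs s') (mem s') \<partial>measure_spmf (exec n inc (Seq (If x p q) r) s)) \<le> \<phi>"
  proof (cases "val x R = 0")
    case True
    then have "exec n inc (Seq (If x p q) r) s = exec n inc (Seq q r) s'"
      using s by (simp add: opval_eq_val s'_def)
    then show ?thesis using s' assms(3)[OF True] unfolding triple_def by auto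
  next
    case False
    then have "exec n inc (Seq (If x p q) r) s = exec n inc (Seq p r) s'"
      using s by (simp add: opval_eq_val s'_def)
    then show ?thesis using s' assms(2)[OF False] unfolding triple_def by auto
  qed
qed

lemma triple_Seq_assoc:
  "triple (Seq p (Seq q r)) k R m Q F \<phi> \<Longrightarrow> triple (Seq (Seq p q) r) k R m Q F \<phi>"
  by (simp add: triple_def)

lemma triple_Skip_Seq:
  "triple q k R m Q F \<phi> \<Longrightarrow> triple (Seq Skip q) k R m Q F \<phi>"
  by (simp add: triple_def)

text \<open>\<open>F\<close> plays the role of a supermartingale: one iteration does not increase
  its expectation. The variant \<open>V\<close> decreases on every outcome, not just on average, so
  well-founded induction gives termination. The final \<open>k0 + 1\<close> pays for the failing
  test.\<close>

lemma triple_While: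
  fixes V :: "(nat \<Rightarrow> nat) \<Rightarrow> (nat \<Rightarrow> nat) \<Rightarrow> nat"
  assumes "I k R m"
    and body: "\<And>k R m. I k R m \<Longrightarrow> val x R \<noteq> 0 \<Longrightarrow>
       triple p (k + 1) R m (\<lambda>k' R' m'. I k' R' m' \<and> V R' m' < V R m) F (F R m)"
    and x: "imm_le M x"
  shows "triple (While x p) k R m (\<lambda>k' R' m'. \<exists>k0<k'. I k0 R' m' \<and> k' = k0 + 1 \<and> val x R' = 0) F (F R m)"
  using assms(1)
proof (induction "V R m" arbitrary: k R m rule: less_induct)
  case less
  let ?Q = "\<lambda>k' R' m'. \<exists>k0<k'. I k0 R' m' \<and> k' = k0 + 1 \<and> val x R' = 0"
  show ?case
    unfolding triple_def
  proof (intro allI impI, elim conjE)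
    fix s assume s: "charged k s" "regs s = R" "mem s = m"
    define s' where "s' = charge [val x R] s"
    have s': "charged (k + 1) s'" "regs s' = R" "mem s' = m"
      using s charged_val_le[OF s(1) x] unfolding s'_def by (auto intro!: charged_step[of k s])
    let ?P = "\<lambda>M. lossless_spmf M \<and> (\<forall>s'\<in>set_spmf M. \<exists>k'. charged k' s' \<and> ?Q k' (regs s') (mem s')) \<and>
        (\<integral>\<^sup>+s'. F (regs s') (mem s') \<partial>measure_spmf M) \<le> F R m"
    show "?P (exec n inc (While x p) s)"
    proof (cases "val x R = 0")
      case True
      then have "exec n inc (While x p) s = return_spmf s'"
        using s by (simp add: loop.simps[of x _ s] opval_eq_val s'_def)
      then show ?thesis using s' less.prems True by (auto simp: nn_integral_return_spmf)
    next
      case False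
      then have *: "exec n inc (While x p) s = exec n inc (Seq p (While x p)) s'"
        using s by (simp add: loop.simps[of x _ s] opval_eq_val s'_def)
      have "triple (Seq p (While x p)) (k + 1) R m ?Q F (F R m)"
        using body[OF less.prems False] less.hyps by (rule triple_Seq) auto
      then show ?thesis using s' * unfolding triple_def by auto
    qed
  qed
qed

end

section \<open>Densities and tail bounds\<close>

definition degree_in :: "nat set set \<Rightarrow> nat set \<Rightarrow> nat \<Rightarrow> nat" where
  "degree_in E S v = card {u \<in> S. {v, u} \<in> E}"

lemma simple_graph_edge:
  assumes "simple_graph n E" "{v, u} \<in> E"
  shows "v < n" "u < n" "v \<noteq> u"
proof -
  have *: "{v, u} \<subseteq> {..<n}" "card {v, u} = 2"
    using assms unfolding simple_graph_def by auto
  then show "v < n" "u < n" "v \<noteq> u" by (auto simp: card_insert_if split: if_splits)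
qed

lemma finite_simple_graph: "simple_graph n E \<Longrightarrow> finite E"
  unfolding simple_graph_def by (rule finite_subset[of _ "Pow {..<n}"]) auto

text \<open>The handshake identity for the subgraph induced by \<open>S\<close>: pairs of a vertex
  and an incident edge are summed in both orders.\<close>

lemma sum_degree_in:
  assumes "simple_graph n E" "finite S"
  shows "(\<Sum>v\<in>S. degree_in E S v) = 2 * card {e \<in> E. e \<subseteq> S}"
proof -
  let ?F = "{e \<in> E. e \<subseteq> S}"
  have fin: "finite ?F" using finite_simple_graph[OF assms(1)] by simp
  have "degree_in E S v = card {e \<in> ?F. v \<in> e}" if "v \<in> S" for v
  proof -
    have "bij_betw (\<lambda>u. {v, u}) {u \<in> S. {v, u} \<in> E} {e \<in> ?F. v \<in> e}"
    proof (rule bij_betw_imageI)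
      show "inj_on (\<lambda>u. {v, u}) {u \<in> S. {v, u} \<in> E}"
        by (auto simp: inj_on_def doubleton_eq_iff)
      show "(\<lambda>u. {v, u}) ` {u \<in> S. {v, u} \<in> E} = {e \<in> ?F. v \<in> e}"
      proof (intro equalityI subsetI)
        fix e assume e: "e \<in> {e \<in> ?F. v \<in> e}"
        then have "card e = 2" using assms(1) by (auto simp: simple_graph_def)
        then obtain u where "e = {v, u}" using e by (auto simp: card_2_iff)
        then show "e \<in> (\<lambda>u. {v, u}) ` {u \<in> S. {v, u} \<in> E}" using e by auto
      qed (use that in auto)
    qed
    then show ?thesis unfolding degree_in_def by (rule bij_betw_same_card)
  qed
  then have "(\<Sum>v\<in>S. degree_in E S v) = (\<Sum>v\<in>S. card {e \<in> ?F. v \<in> e})"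
    by simp
  also have "\<dots> = (\<Sum>v\<in>S. \<Sum>e\<in>?F. if v \<in> e then 1 else 0)"
    using fin by (simp add: sum.If_cases Int_def conj_commute)
  also have "\<dots> = (\<Sum>e\<in>?F. \<Sum>v\<in>S. if v \<in> e then 1 else 0)"
    by (rule sum.swap)
  also have "\<dots> = (\<Sum>e\<in>?F. 2)"
  proof (rule sum.cong)
    fix e assume "e \<in> ?F"
    then have "S \<inter> e = e" "card e = 2" using assms(1) by (auto simp: simple_graph_def)
    then show "(\<Sum>v\<in>S. if v \<in> e then 1 else 0) = (2 :: nat)"
      using assms(2) by (simp add: sum.If_cases Int_def)
  qed simp
  finally show ?thesis by simp
qed

lemma degree_in_nth:
  assumes "incidence_lists n E inc" "v < n"
  shows "degree_in E S v = (\<Sum>i<length (inc v). if inc v ! i \<in> S then 1 else 0)"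
proof -
  have d: "distinct (inc v)" and s: "set (inc v) = {u. {v, u} \<in> E}"
    using assms by (auto simp: incidence_lists_def)
  have "{u \<in> S. {v, u} \<in> E} = (!) (inc v) ` {i \<in> {..<length (inc v)}. inc v ! i \<in> S}"
    using s unfolding set_conv_nth by auto
  moreover have "inj_on ((!) (inc v)) {i \<in> {..<length (inc v)}. inc v ! i \<in> S}"
    using d by (auto simp: inj_on_def nth_eq_iff_index_eq)
  ultimately have "degree_in E S v = card {i \<in> {..<length (inc v)}. inc v ! i \<in> S}"
    unfolding degree_in_def by (simp add: card_image)
  then show ?thesis by (simp add: sum.If_cases Int_def)
qed

lemma length_incidence_list:
  assumes "simple_graph n E" "incidence_lists n E inc" "v < n"
  shows "length (inc v) = degree_in E {..<n} v"
proof -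
  have "set (inc v) = {u \<in> {..<n}. {v, u} \<in> E}"
    using assms simple_graph_edge[OF assms(1)] by (auto simp: incidence_lists_def)
  then show ?thesis
    using assms(2,3) distinct_card[of "inc v"] by (simp add: incidence_lists_def degree_in_def)
qed

lemma degree_in_le: "degree_in E S v \<le> card S" if "finite S"
  unfolding degree_in_def using that by (intro card_mono) auto

lemma degree_in_mono: "S \<subseteq> T \<Longrightarrow> finite T \<Longrightarrow> degree_in E S v \<le> degree_in E T v"
  unfolding degree_in_def by (intro card_mono) auto

locale densest =
  fixes n :: nat and E :: "nat set set" and \<rho> :: real
  assumes n_pos: "n > 0" and simple: "simple_graph n E"
  defines "\<rho> \<equiv> densest_value {..<n} E"
begin

lemma finite_densities: "finite {density E S | S. S \<noteq> {} \<and> S \<subseteq> {..<n}}"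
proof -
  have "{density E S | S. S \<noteq> {} \<and> S \<subseteq> {..<n}} \<subseteq> density E ` Pow {..<n}" by auto
  then show ?thesis by (rule finite_subset) simp
qed

lemma edges_le:
  assumes "S \<subseteq> {..<n}"
  shows "real (card {e \<in> E. e \<subseteq> S}) \<le> \<rho> * real (card S)"
proof (cases "S = {}")
  case True
  have "{e \<in> E. e \<subseteq> {}} = {}" using simple by (auto simp: simple_graph_def)
  then show ?thesis using True by simp
next
  case False
  then have "density E S \<le> \<rho>"
    unfolding \<rho>_def densest_value_def by (intro Max_ge[OF finite_densities]) (use assms in auto)
  moreover have "card S > 0"
    using False finite_subset[OF assms] by (simp add: card_gt_0_iff)
  ultimately show ?thesis by (simp add: density_def divide_le_eq)
qed

lemma value_nonneg: "0 \<le> \<rho>"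
  using edges_le[of "{..<n}"] n_pos
  by (smt (verit) card_lessThan of_nat_0_le_iff order_refl of_nat_0_less_iff mult_neg_pos)

lemma sum_degree_in_le:
  assumes "S \<subseteq> {..<n}"
  shows "(\<Sum>v\<in>S. real (degree_in E S v)) \<le> 2 * \<rho> * real (card S)"
proof -
  have "(\<Sum>v\<in>S. real (degree_in E S v)) = 2 * real (card {e \<in> E. e \<subseteq> S})"
    using sum_degree_in[OF simple finite_subset[OF assms]]
    by (metis finite_lessThan of_nat_mult of_nat_numeral of_nat_sum)
  then show ?thesis using edges_le[OF assms] by simp
qed

text \<open>Deleting a vertex of degree less than \<open>\<rho>\<close> would increase the density of an optimal set.\<close>

lemma obtain_optimum:
  obtains S where "S \<noteq> {}" "S \<subseteq> {..<n}" "\<And>v. v \<in> S \<Longrightarrow> \<rho> \<le> real (degree_in E S v)"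
proof -
  have ne: "{density E S | S. S \<noteq> {} \<and> S \<subseteq> {..<n}} \<noteq> {}"
    using n_pos by auto
  then obtain S where S: "S \<noteq> {}" "S \<subseteq> {..<n}" "\<rho> = density E S"
    using Max_in[OF finite_densities ne] unfolding \<rho>_def densest_value_def by blast
  have fin: "finite S" using S(2) finite_subset by blast
  have c: "card S > 0" using S(1) fin by (simp add: card_gt_0_iff)
  have "\<rho> \<le> real (degree_in E S v)" if v: "v \<in> S" for v
  proof -
    let ?T = "S - {v}"
    have finE: "finite E" by (rule finite_simple_graph[OF simple])
    \<comment> \<open>Deleting \<open>v\<close> loses at most \<open>degree_in E S v\<close> edges,
      and at most \<open>\<rho> * (card S - 1)\<close> remain; comparing with the
      \<open>\<rho> * card S\<close> edges of \<open>S\<close> leaves \<open>\<rho>\<close>.\<close>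
    have "{e \<in> E. e \<subseteq> S} \<subseteq> {e \<in> E. e \<subseteq> ?T} \<union> (\<lambda>u. {v, u}) ` {u \<in> S. {v, u} \<in> E}"
    proof
      fix e assume e: "e \<in> {e \<in> E. e \<subseteq> S}"
      then have "card e = 2" using simple by (auto simp: simple_graph_def)
      then show "e \<in> {e \<in> E. e \<subseteq> ?T} \<union> (\<lambda>u. {v, u}) ` {u \<in> S. {v, u} \<in> E}"
        using e by (cases "v \<in> e") (auto simp: card_2_iff insert_commute)
    qed
    then have "card {e \<in> E. e \<subseteq> S} \<le> card ({e \<in> E. e \<subseteq> ?T} \<union> (\<lambda>u. {v, u}) ` {u \<in> S. {v, u} \<in> E})"
      using finE fin by (intro card_mono) auto
    also have "\<dots> \<le> card {e \<in> E. e \<subseteq> ?T} + degree_in E S v"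
      unfolding degree_in_def using fin
      by (intro order_trans[OF card_Un_le] add_left_mono card_image_le) auto
    finally have "real (card {e \<in> E. e \<subseteq> S}) \<le> real (card {e \<in> E. e \<subseteq> ?T}) + real (degree_in E S v)"
      by linarith
    \<comment> \<open>\<open>edges_le\<close> also covers the empty set, which occurs when the
      optimum is a single vertex.\<close>
    moreover have "real (card {e \<in> E. e \<subseteq> ?T}) \<le> \<rho> * real (card ?T)"
      using S(2) by (intro edges_le) auto
    moreover have "real (card ?T) = real (card S) - 1"
      using v c by (simp add: card_Diff_singleton of_nat_diff)
    moreover have "real (card {e \<in> E. e \<subseteq> S}) = \<rho> * real (card S)"
      using S(3) c by (simp add: density_def)
    ultimately show ?thesis by (simp add: algebra_simps)
  qed
  then show ?thesis using that S by blast
qed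

end

text \<open>For an exponent 0 or 1 the power \<open>\<beta> ^ a\<close> is affine in
  \<open>a\<close>, so its average over a block is 1 plus \<open>\<beta> - 1\<close> times the mean.
  Passing to \<open>exp\<close> makes the bounds of different blocks multiply to an expression in
  the total number of hits.\<close>

lemma block_moment_le:
  fixes a :: "nat \<Rightarrow> nat" and \<beta> :: real
  assumes "B > 0" "\<And>i. a i \<le> 1"
  shows "(\<Sum>b\<le>B - 1. \<beta> ^ a b) \<le> exp ((\<beta> - 1) * (\<Sum>b<B. a b) / B) * real B"
proof -
  have *: "{..B - 1} = {..<B}" using assms(1) by auto
  have "\<beta> ^ a i = 1 + (\<beta> - 1) * a i" for i
    using assms(2)[of i] by (cases "a i") auto
  then have "(\<Sum>b\<le>B - 1. \<beta> ^ a b) = B + (\<beta> - 1) * (\<Sum>b<B. a b)"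
    unfolding * by (simp add: sum.distrib sum_distrib_left)
  also have "\<dots> = (1 + (\<beta> - 1) * (\<Sum>b<B. a b) / B) * B"
    using assms(1) by (simp add: field_simps)
  also have "\<dots> \<le> exp ((\<beta> - 1) * (\<Sum>b<B. a b) / B) * B"
    by (intro mult_right_mono exp_ge_add_one_self) simp
  finally show ?thesis .
qed

text \<open>
  The indicator of a large deviation of a count \<open>x\<close> with mean \<open>\<mu>\<close> is dominated by a multiple of
  \<open>\<beta> ^ x\<close>, whose expectation is at most \<open>exp ((\<beta> - 1) * \<mu>)\<close>. The choice \<open>\<beta> = 1 \<plusminus> \<delta>\<close> is not
  the optimal one of Chernoff's bound but makes the terms in \<open>\<mu>\<close> cancel.
\<close>

lemma upper_tail_weight:
  fixes \<delta> \<mu> \<nu> :: real and x :: nat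
  assumes "0 < \<delta>" "\<delta> < 1" "0 \<le> \<mu>" "0 \<le> \<nu>" "x > (1 + \<delta>) * \<mu> + \<delta> * \<nu>"
  shows "1 \<le> (1 + \<delta>) ^ x * exp (- (\<delta> * \<mu> + \<delta>\<^sup>2 * \<nu> / 2))"
proof -
  \<comment> \<open>Two bounds on the same logarithm: the sharper one meets
    \<open>(1 + \<delta>) * \<mu>\<close> and returns exactly \<open>\<delta> * \<mu>\<close>, the
    simpler \<open>\<delta> / 2\<close> is enough in front of \<open>\<nu>\<close>.\<close>
  have l: "ln (1 + \<delta>) \<ge> \<delta> / (1 + \<delta>)"
    using ln_diff_le[of 1 "1 + \<delta>"] assms by (simp add: field_simps)
  then have l1: "ln (1 + \<delta>) * (1 + \<delta>) \<ge> \<delta>" using assms by (simp add: field_simps)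
  have l0: "ln (1 + \<delta>) \<ge> 0" using assms by simp
  have "\<delta> / 2 \<le> \<delta> / (1 + \<delta>)" using assms by (intro divide_left_mono) auto
  with l have l2: "ln (1 + \<delta>) \<ge> \<delta> / 2" by linarith
  have "\<delta> * \<mu> + \<delta>\<^sup>2 * \<nu> / 2 = \<delta> * \<mu> + (\<delta> / 2) * (\<delta> * \<nu>)"
    by (simp add: power2_eq_square)
  also have "\<dots> \<le> (ln (1 + \<delta>) * (1 + \<delta>)) * \<mu> + ln (1 + \<delta>) * (\<delta> * \<nu>)"
    using l1 l2 assms by (intro add_mono mult_right_mono) auto
  also have "\<dots> = ln (1 + \<delta>) * ((1 + \<delta>) * \<mu> + \<delta> * \<nu>)"
    by (simp add: algebra_simps)
  also have "\<dots> \<le> ln (1 + \<delta>) * x"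
    using assms(5) l0 by (intro mult_left_mono) auto
  finally have "0 \<le> ln (1 + \<delta>) * x - (\<delta> * \<mu> + \<delta>\<^sup>2 * \<nu> / 2)" by simp
  then have "1 \<le> exp (ln (1 + \<delta>) * x - (\<delta> * \<mu> + \<delta>\<^sup>2 * \<nu> / 2))" by simp
  also have "\<dots> = (1 + \<delta>) ^ x * exp (- (\<delta> * \<mu> + \<delta>\<^sup>2 * \<nu> / 2))"
    using assms by (simp only: diff_conv_add_uminus exp_add exp_of_nat2_mult) simp
  finally show ?thesis .
qed

lemma lower_tail_weight:
  fixes \<delta> \<mu> \<nu> :: real and x :: nat
  assumes "0 < \<delta>" "\<delta> < 1" "0 \<le> \<mu>" "0 \<le> \<nu>" "x < (1 - \<delta>) * \<mu> - \<delta> * \<nu>"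
  shows "1 \<le> (1 - \<delta>) ^ x * exp (\<delta> * \<mu> - \<delta>\<^sup>2 * \<nu> / 2)"
proof -
  have "ln (inverse (1 - \<delta>)) \<le> inverse (1 - \<delta>) - 1"
    using assms by (intro ln_le_minus_one) auto
  moreover have "ln (inverse (1 - \<delta>)) = - ln (1 - \<delta>)"
    using assms by (simp add: ln_inverse)
  moreover have "inverse (1 - \<delta>) - 1 = \<delta> / (1 - \<delta>)"
    using assms by (simp add: field_simps)
  ultimately have "- ln (1 - \<delta>) \<le> \<delta> / (1 - \<delta>)" by simp
  then have l1: "ln (1 - \<delta>) * (1 - \<delta>) \<ge> - \<delta>" using assms by (simp add: field_simps)
  \<comment> \<open>On this side \<open>\<nu>\<close> would even receive the factor
    \<open>\<delta>\<^sup>2\<close>; half of it is kept so that both tails share one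
    exponent.\<close>
  have l2: "ln (1 - \<delta>) \<le> - \<delta>"
    using ln_le_minus_one[of "1 - \<delta>"] assms by simp
  have "\<delta>\<^sup>2 * \<nu> / 2 - \<delta> * \<mu> \<le> (- \<delta>) * \<mu> - (- \<delta>) * (\<delta> * \<nu>)"
    using assms by (simp add: power2_eq_square)
  also have "\<dots> \<le> (ln (1 - \<delta>) * (1 - \<delta>)) * \<mu> - ln (1 - \<delta>) * (\<delta> * \<nu>)"
    using l1 l2 assms by (intro diff_mono mult_right_mono) auto
  also have "\<dots> = ln (1 - \<delta>) * ((1 - \<delta>) * \<mu> - \<delta> * \<nu>)"
    by (simp add: algebra_simps)
  also have "\<dots> \<le> ln (1 - \<delta>) * x"
    using assms l2 by (intro mult_left_mono_neg) auto
  finally have "0 \<le> ln (1 - \<delta>) * x + (\<delta> * \<mu> - \<delta>\<^sup>2 * \<nu> / 2)" by simp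
  then have "1 \<le> exp (ln (1 - \<delta>) * x + (\<delta> * \<mu> - \<delta>\<^sup>2 * \<nu> / 2))" by simp
  also have "\<dots> = (1 - \<delta>) ^ x * exp (\<delta> * \<mu> - \<delta>\<^sup>2 * \<nu> / 2)"
    using assms by (simp only: exp_add exp_of_nat2_mult) simp
  finally show ?thesis .
qed

section \<open>The program\<close>

text \<open>
  Registers: 0 holds \<open>n\<close>, 1 the logarithm, 2 the degree sum, 3 the block length, 4 the number of
  alive vertices, 5 and 6 the best density found so far, 7 the total count of the pass, 8 the
  current vertex, 14 the last offset in a block. Memory: cell \<open>x < n\<close> is nonzero iff vertex \<open>x\<close>
  has been removed, cell \<open>n\<close> marks the non-vertex \<open>n\<close> as removed, cell \<open>n + 1 + x\<close> holds the
  count of \<open>x\<close>.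
\<close>

definition log_prog :: prog where
  "log_prog = While (Reg 9) (block [
     Do (Op 1 Add (Reg 1) (Imm 1)),
     Do (Op 9 Div (Reg 9) (Imm 2))])"

definition degree_sum_prog :: prog where
  "degree_sum_prog = While (Reg 8) (block [
     Do (Op 8 Sub (Reg 8) (Imm 1)),
     Do (Degree 9 (Reg 8)),
     Do (Op 2 Add (Reg 2) (Reg 9))])"

text \<open>Blocks are visited from the last to the first, so that the decremented loop counter
  serves as block index. The last block may overhang the list.\<close>

definition sample_prog :: prog where
  "sample_prog = While (Reg 10) (block [
     Do (Op 10 Sub (Reg 10) (Imm 1)),
     Do (Random 12 (Reg 14)),
     Do (Op 13 Mul (Reg 10) (Reg 3)),
     Do (Op 13 Add (Reg 13) (Reg 12)),
     Do (Neighbor 13 (Reg 8) (Reg 13)),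
     Do (Load 13 (Reg 13)),
     Do (Op 13 Sub (Imm 1) (Reg 13)),
     Do (Op 11 Add (Reg 11) (Reg 13))])"

definition count_prog :: prog where
  "count_prog = While (Reg 8) (block [
     Do (Op 8 Sub (Reg 8) (Imm 1)),
     Do (Load 9 (Reg 8)),
     If (Reg 9) Skip (block [
       Do (Op 11 Add (Imm 0) (Imm 0)),
       Do (Degree 10 (Reg 8)),
       Do (Op 10 Add (Reg 10) (Reg 14)),
       Do (Op 10 Div (Reg 10) (Reg 3)),
       sample_prog,
       Do (Op 12 Add (Reg 0) (Reg 8)),
       Do (Op 12 Add (Reg 12) (Imm 1)),
       Do (Store (Reg 12) (Reg 11)),
       Do (Op 7 Add (Reg 7) (Reg 11))])])"

text \<open>Registers 9 and 13 hold \<open>q\<close> times the number of alive vertices and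
  \<open>q + 1\<close> times the total count, so the test says that a count is at most
  \<open>1 + 1 / q\<close> times the average. The average degree is twice the density, which makes
  this the deletion threshold.\<close>

definition remove_prog :: prog where
  "remove_prog = While (Reg 8) (block [
     Do (Op 8 Sub (Reg 8) (Imm 1)),
     Do (Load 12 (Reg 8)),
     If (Reg 12) Skip (block [
       Do (Op 12 Add (Reg 0) (Reg 8)),
       Do (Op 12 Add (Reg 12) (Imm 1)),
       Do (Load 12 (Reg 12)),
       Do (Op 12 Mul (Reg 12) (Reg 9)),
       Do (Op 12 Sub (Reg 12) (Reg 13)),
       If (Reg 12) Skip (block [
         Do (Store (Reg 8) (Imm 1)),
         Do (Op 4 Sub (Reg 4) (Imm 1))])])])"

text \<open>The best pair is compared as a fraction, by cross multiplication. The factor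
  \<open>B\<close> is common to all passes and is applied only to the final result.\<close>

definition pass_prog :: "nat \<Rightarrow> prog" where
  "pass_prog q = block [
     Do (Op 7 Add (Imm 0) (Imm 0)),
     Do (Op 8 Add (Reg 0) (Imm 0)),
     count_prog,
     Do (Op 12 Mul (Reg 7) (Reg 6)),
     Do (Op 13 Mul (Reg 5) (Reg 4)),
     Do (Op 12 Sub (Reg 12) (Reg 13)),
     If (Reg 12) (block [
       Do (Op 5 Add (Reg 7) (Imm 0)),
       Do (Op 6 Add (Reg 4) (Imm 0))]) Skip,
     Do (Op 9 Mul (Reg 4) (Imm q)),
     Do (Op 13 Mul (Reg 7) (Imm (q + 1))),
     Do (Op 8 Add (Reg 0) (Imm 0)),
     remove_prog]"

text \<open>Of the factor 8, one 2 comes from the tail exponent, one from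
  \<open>degree_sum <= 2 * \<rho> * n\<close> and one from the rounding in \<open>B\<close>. In
  \<open>c + 3\<close>, two powers of \<open>n\<close> pay for the union bound over passes and
  vertices, and one absorbs the constant 2 of the two tails.\<close>

definition sample_rate :: "nat \<Rightarrow> nat \<Rightarrow> nat" where
  "sample_rate c q = 8 * q\<^sup>2 * (c + 3)"

text \<open>With the best pair \<open>a\<close>, \<open>b\<close>, the result is the estimated
  average degree \<open>B * a / b\<close>, divided by 2 to become a density and by
  \<open>1 + 2 / q\<close> so that overestimates stay below the optimum.\<close>

definition densest_prog :: "nat \<Rightarrow> nat \<Rightarrow> prog" where
  "densest_prog c q = block [
     Do (Op 9 Add (Reg 0) (Imm 0)),
     log_prog,
     Do (Op 8 Add (Reg 0) (Imm 0)),
     degree_sum_prog,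
     Do (Op 9 Mul (Reg 0) (Reg 1)),
     Do (Op 9 Mul (Reg 9) (Imm (sample_rate c q))),
     Do (Op 14 Div (Reg 2) (Reg 9)),
     Do (Op 3 Add (Reg 14) (Imm 1)),
     Do (Store (Reg 0) (Imm 1)),
     Do (Op 4 Add (Reg 0) (Imm 0)),
     Do (Op 6 Add (Imm 1) (Imm 0)),
     While (Reg 4) (pass_prog q),
     Do (Op 0 Mul (Reg 3) (Reg 5)),
     Do (Op 0 Mul (Reg 0) (Imm q)),
     Do (Op 1 Mul (Reg 6) (Imm (2 * (q + 2))))]"

section \<open>Parameters of a run and the count of a single vertex\<close>

locale densest_run =
  fixes n :: nat and E :: "nat set set" and inc :: "nat \<Rightarrow> nat list" and c q :: nat
  assumes n_pos: "n > 0" and simple: "simple_graph n E" and incidence: "incidence_lists n E inc"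
    and q_ge: "q \<ge> 17"
begin

definition t :: nat where "t = sample_rate c q"
text \<open>The fourth power accommodates the product \<open>B * R 5 * q\<close> in the output, with
  \<open>B\<close> at most \<open>n^2 + 1\<close> and \<open>R 5\<close> at most \<open>n^2\<close>.
  The factor \<open>t\<close> dominates the constants that depend on \<open>q\<close>.\<close>

definition M :: nat where "M = t * (n + 2) ^ 4"
definition degree_sum :: nat where "degree_sum = (\<Sum>v<n. length (inc v))"
definition B :: nat where "B = degree_sum div (n * floorlog 2 n * t) + 1"

lemma length_le: "v < n \<Longrightarrow> length (inc v) \<le> n"
  using length_incidence_list[OF simple incidence] degree_in_le[of "{..<n}" E v] by simp

lemma neighbor_less: "v < n \<Longrightarrow> u \<in> set (inc v) \<Longrightarrow> u < n"
  using incidence simple_graph_edge[OF simple] by (auto simp: incidence_lists_def)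

lemma t_ge: "t \<ge> 2 * (q + 2)" "t \<ge> q + 1" "t \<ge> 16"
proof -
  have "q * 17 \<le> q * q" using q_ge by simp
  then have "q \<le> q\<^sup>2" by (simp add: power2_eq_square)
  moreover have "8 * q\<^sup>2 * 3 \<le> t" unfolding t_def sample_rate_def by simp
  ultimately have "24 * q \<le> t" by linarith
  then show "t \<ge> 2 * (q + 2)" "t \<ge> q + 1" "t \<ge> 16"
    using q_ge by simp_all
qed

lemma M_ge: "x \<le> t \<Longrightarrow> y \<le> (n + 2) ^ 4 \<Longrightarrow> x * y \<le> M"
  unfolding M_def by (rule mult_mono) auto

lemma M_ge': "y \<le> (n + 2) ^ 4 \<Longrightarrow> y \<le> M"
  using M_ge[of 1 y] t_ge by simp

lemma M_ge_affine: "16 * n + 16 \<le> M"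
proof -
  have "(n + 2) * 1 \<le> (n + 2) * (n + 2) ^ 3" by (rule mult_le_mono2) simp
  then have "16 * (n + 2) \<le> M" using t_ge by (intro M_ge) (auto simp: eval_nat_numeral)
  then show ?thesis by simp
qed

definition cells :: nat where "cells = 2 * n + 2"

sublocale ram n inc 15 cells M
proof
  show "15 \<le> M" "cells \<le> M" "n \<le> M" using M_ge_affine by (auto simp: cells_def)
  show "length (inc v) \<le> n" if "v < n" for v using that by (rule length_le)
  show "u \<le> n" if "v < n" "u \<in> set (inc v)" for u v using neighbor_less[OF that] by simp
qed

sublocale densest n E "densest_value {..<n} E"
  using n_pos simple by unfold_locales auto

abbreviation "\<rho> \<equiv> densest_value {..<n} E"

lemma degree_sum_le: "degree_sum \<le> n\<^sup>2"
proof -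
  have "degree_sum \<le> (\<Sum>v<n. n)" unfolding degree_sum_def by (rule sum_mono) (simp add: length_le)
  then show ?thesis by (simp add: power2_eq_square)
qed

lemma B_pos: "B > 0" by (simp add: B_def)

lemma B_le: "B \<le> n\<^sup>2 + 1"
  using degree_sum_le div_le_dividend[of degree_sum "n * floorlog 2 n * t"]
  unfolding B_def by linarith

lemma B_M: "4 * (n * B) \<le> M" "B + 4 * n \<le> M"
proof -
  have "n * B \<le> n * (n\<^sup>2 + 1)" by (rule mult_le_mono2[OF B_le])
  also have "\<dots> \<le> (n + 2) ^ 4" by (simp add: power2_eq_square power4_eq_xxxx algebra_simps)
  finally have "4 * (n * B) \<le> t * (n + 2) ^ 4" using t_ge by (intro mult_mono) auto
  then show *: "4 * (n * B) \<le> M" by (simp add: M_def)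
  have "B + 4 * n \<le> (n + 2) ^ 4" using B_le by (simp add: power2_eq_square power4_eq_xxxx algebra_simps)
  then show "B + 4 * n \<le> M" by (rule M_ge')
qed

text \<open>Rounding \<open>d / B\<close> upwards gives 0 for an empty list and otherwise at most
  \<open>d\<close>. Hence no count exceeds the length of its list, and the total of a pass is at
  most \<open>degree_sum\<close>.\<close>

lemma blocks_le: "(d + (B - 1)) div B \<le> d"
proof (cases d)
  case (Suc d')
  have "(d + (B - 1)) div B = (d' + B) div B" using Suc B_pos by simp
  also have "\<dots> = Suc (d' div B)" using B_pos by simp
  also have "\<dots> \<le> d" using Suc div_le_dividend by simp
  finally show ?thesis .
qed (use B_pos in simp)

lemma blocks_cover: "d \<le> (d + (B - 1)) div B * B" "(d + (B - 1)) div B * B \<le> d + B"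
proof -
  have "(d + (B - 1)) div B * B + (d + (B - 1)) mod B = d + (B - 1)" by simp
  moreover have "(d + (B - 1)) mod B < B" using B_pos by simp
  ultimately show "d \<le> (d + (B - 1)) div B * B" "(d + (B - 1)) div B * B \<le> d + B" by linarith+
qed

definition alive :: "(nat \<Rightarrow> nat) \<Rightarrow> nat set" where
  "alive m = {x. x < n \<and> m x = 0}"

lemma alive_subset: "alive m \<subseteq> {..<n}" and finite_alive: "finite (alive m)"
  by (auto simp: alive_def)

text \<open>The truncated subtraction sends all nonzero marks to 0.\<close>

lemma sum_alive_positions:
  assumes "v < n" "m n \<noteq> 0" "length (inc v) \<le> N"
  shows "(\<Sum>i<N. 1 - m (neighbor_answer n inc v i)) = degree_in E (alive m) v"
proof -
  \<comment> \<open>Positions past the end of the list are answered by \<open>n\<close>; cell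
    \<open>n\<close> is nonzero, so they add 0.\<close>
  have "(\<Sum>i<N. 1 - m (neighbor_answer n inc v i)) = (\<Sum>i<length (inc v). 1 - m (neighbor_answer n inc v i))"
    using assms by (intro sum.mono_neutral_right) (auto simp: neighbor_answer_def)
  also have "\<dots> = (\<Sum>i<length (inc v). if inc v ! i \<in> alive m then 1 else 0)"
    using assms(1) neighbor_less[OF assms(1) nth_mem]
    by (intro sum.cong) (auto simp: neighbor_answer_def alive_def)
  finally show ?thesis by (simp add: degree_in_nth[OF incidence assms(1)])
qed

lemma sum_lessThan_add: "(\<Sum>i<x + y. f i) = (\<Sum>i<x. f i) + (\<Sum>i<y. f (x + i))"
  for f :: "nat \<Rightarrow> 'a :: comm_monoid_add"
  by (induction y) (simp_all add: add_ac)

text \<open>Kept for general \<open>\<beta>\<close>, since the two tails are the instances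
  \<open>1 \<plusminus> \<delta>\<close>. Each iteration is charged nine times: eight instructions
  and the test.\<close>

lemma sample_triple:
  fixes \<beta> :: real
  assumes "v < n" "m n \<noteq> 0" "\<beta> \<ge> 0"
    and "R 3 = B" "R 8 = v" "R 14 = B - 1" "R 11 = 0" "R 10 = (length (inc v) + (B - 1)) div B"
  shows "triple sample_prog k R m
     (\<lambda>k' R' m'. m' = m \<and> k' \<le> k + 9 * R 10 + 1 \<and> (\<forall>r. r \<notin> {10,11,12,13} \<longrightarrow> R' r = R r) \<and>
        R' 11 \<le> length (inc v) \<and> (B = 1 \<longrightarrow> R' 11 = degree_in E (alive m) v))
     (\<lambda>R' m'. ennreal (\<beta> ^ R' 11)) (ennreal (exp ((\<beta> - 1) * (degree_in E (alive m) v / B))))"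
proof -
  define j0 where "j0 = (length (inc v) + (B - 1)) div B"
  define a where "a i = 1 - m (neighbor_answer n inc v i)" for i
  have a_le: "a i \<le> 1" for i by (simp add: a_def)
  have a_sum: "(\<Sum>i<j0 * B. a i) = degree_in E (alive m) v"
    unfolding a_def j0_def using assms(1,2) blocks_cover(1) by (rule sum_alive_positions)
  \<comment> \<open>The hits drawn so far enter exactly, the blocks still to be drawn through the
    bound on their moments. A draw replaces one factor of the second kind by one of the first, and
    \<open>block_moment_le\<close> says that the expectation does not grow.\<close>
  define F where "F R m = ennreal (\<beta> ^ R 11 * exp ((\<beta> - 1) * (real (\<Sum>i<R 10 * B. a i) / B)))"
    for R m :: "nat \<Rightarrow> nat"
  define I where "I k' R' m' \<longleftrightarrow> m' = m \<and> k' + 9 * R' 10 \<le> k + 9 * j0 \<and>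
     (\<forall>r. r \<notin> {10,11,12,13} \<longrightarrow> R' r = R r) \<and> R' 11 + R' 10 \<le> j0 \<and>
     (B = 1 \<longrightarrow> R' 11 + (\<Sum>i<R' 10. a i) = degree_in E (alive m) v)" for k' R' m'
  have j0_le: "j0 \<le> length (inc v)" unfolding j0_def by (rule blocks_le)
  have j0_le_n: "j0 \<le> n" using j0_le length_le[OF assms(1)] by simp
  have M: "n \<le> M" "B \<le> M" "B - 1 \<le> M" "j0 * B \<le> M" "1 \<le> M"
    using B_M blocks_cover(2)[of "length (inc v)"] length_le[OF assms(1)] M_ge_affine
    by (auto simp: j0_def)
  have "triple sample_prog k R m (\<lambda>k' R' m'. \<exists>k0<k'. I k0 R' m' \<and> k' = k0 + 1 \<and> val (Reg 10) R' = 0) F (F R m)"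
    unfolding sample_prog_def
  proof (rule triple_While[where V = "\<lambda>R m. R 10"])
    show "I k R m"
      using a_sum assms by (auto simp: I_def j0_def)
    fix k' R' m'
    assume I: "I k' R' m'" and "val (Reg 10) R' \<noteq> 0"
    then obtain j where j: "R' 10 = Suc j" by (auto simp: gr0_conv_Suc)
    have [simp]: "R' 3 = B" "R' 8 = v" "R' 14 = B - 1" "m' = m"
      using I assms by (auto simp: I_def)
    have c: "R' 11 + Suc j \<le> j0" using I j by (simp add: I_def)
    have idx: "j * B + b \<le> M" if "b \<le> B - 1" for b
    proof -
      have "j * B + b \<le> Suc j * B" using that B_pos by simp
      also have "\<dots> \<le> j0 * B" using c by (intro mult_le_mono1) simp
      finally show ?thesis using M by simp
    qed
    have jM: "j * B \<le> M" using idx[of 0] by simp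
    have cM: "R' 11 + a i \<le> M" "R' 11 \<le> M" "Suc j \<le> M" "j \<le> M" for i
      using c j0_le_n M a_le[of i] assms(1) by auto
    define f where "f b = \<beta> ^ R' 11 * exp ((\<beta> - 1) * (real (\<Sum>i<j * B. a i) / B)) * \<beta> ^ a (j * B + b)" for b
    have split: "(\<Sum>i<Suc j * B. a i) = (\<Sum>i<j * B. a i) + (\<Sum>b<B. a (j * B + b))"
      using sum_lessThan_add[of a "j * B" B] by (simp add: add.commute)
    have f_nonneg: "f b \<ge> 0" for b unfolding f_def using assms(3) by simp
    have fsum: "(\<Sum>b\<le>B - 1. f b) \<le>
        \<beta> ^ R' 11 * exp ((\<beta> - 1) * (real (\<Sum>i<Suc j * B. a i) / B)) * real (Suc (B - 1))"
    proof -
      let ?c = "\<beta> ^ R' 11 * exp ((\<beta> - 1) * (real (\<Sum>i<j * B. a i) / B))"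
      have "(\<Sum>b\<le>B - 1. f b) = ?c * (\<Sum>b\<le>B - 1. \<beta> ^ a (j * B + b))"
        unfolding f_def by (rule sum_distrib_left[symmetric])
      also have "\<dots> \<le> ?c * (exp ((\<beta> - 1) * (\<Sum>b<B. a (j * B + b)) / B) * B)"
        using assms(3) B_pos a_le by (intro mult_left_mono block_moment_le) auto
      also have "\<dots> = \<beta> ^ R' 11 * exp ((\<beta> - 1) * (real (\<Sum>i<j * B. a i) / B) +
           (\<beta> - 1) * (\<Sum>b<B. a (j * B + b)) / B) * real (Suc (B - 1))"
        using B_pos by (simp add: exp_add)
      also have "(\<beta> - 1) * (real (\<Sum>i<j * B. a i) / B) + (\<beta> - 1) * (\<Sum>b<B. a (j * B + b)) / B =
          (\<beta> - 1) * (real (\<Sum>i<Suc j * B. a i) / B)"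
        unfolding split by (simp add: add_divide_distrib algebra_simps)
      finally show ?thesis .
    qed
    have step: "I (k' + 1 + 1 + 1 + 1 + 1 + 1 + 1 + 1 + 1) R'' m \<and> R'' 10 < R' 10 \<and> F R'' m \<le> ennreal (f b)"
      if "R'' = R'(10 := j, 12 := b, 13 := a (j * B + b), 11 := R' 11 + a (j * B + b))" "b \<le> B - 1" for b R''
    proof (intro conjI)
      show "I (k' + 1 + 1 + 1 + 1 + 1 + 1 + 1 + 1 + 1) R'' m"
        using I that j c a_le[of "j * B + b"] by (auto simp: I_def)
      show "R'' 10 < R' 10" using that j by simp
      show "F R'' m \<le> ennreal (f b)"
        unfolding F_def f_def using that(1) by (intro ennreal_leI) (simp add: power_add mult_ac)
    qed
    define Q where "Q k'' R'' m'' \<longleftrightarrow> I k'' R'' m'' \<and> R'' 10 < R' 10" for k'' R'' m''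
    define g where "g = \<beta> ^ R' 11 * exp ((\<beta> - 1) * (real (\<Sum>i<Suc j * B. a i) / B))"
    have *: "triple (block [
        Do (Op 10 Sub (Reg 10) (Imm 1)),
        Do (Random 12 (Reg 14)),
        Do (Op 13 Mul (Reg 10) (Reg 3)),
        Do (Op 13 Add (Reg 13) (Reg 12)),
        Do (Neighbor 13 (Reg 8) (Reg 13)),
        Do (Load 13 (Reg 13)),
        Do (Op 13 Sub (Imm 1) (Reg 13)),
        Do (Op 11 Add (Reg 11) (Reg 13))]) (k' + 1) R' m Q F (ennreal g)"
      unfolding foldr.simps o_apply id_apply
      apply (rule triple_Op; (simp add: j M del: One_nat_def)?)
      apply (rule triple_Random[where f = f]; (simp add: f_nonneg fsum[folded g_def] del: One_nat_def of_nat_Suc)?)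
      subgoal premises b for b
        using idx[OF b]
        apply -
        apply (rule triple_Op; (simp add: jM del: One_nat_def)?)
        apply (rule triple_Op; (simp del: One_nat_def)?)
        apply (rule triple_Neighbor; (simp del: One_nat_def)?)
        apply (rule triple_Load; (simp del: One_nat_def)?)
        apply (rule triple_Op; (simp add: M del: One_nat_def)?)
        apply (rule triple_Op; (simp add: cM flip: a_def del: One_nat_def)?)
        apply (rule triple_Skip)
        using step[OF refl b] apply (simp_all add: Q_def)
        done
      done
    then show "triple (block [
        Do (Op 10 Sub (Reg 10) (Imm 1)),
        Do (Random 12 (Reg 14)),
        Do (Op 13 Mul (Reg 10) (Reg 3)),
        Do (Op 13 Add (Reg 13) (Reg 12)),
        Do (Neighbor 13 (Reg 8) (Reg 13)),
        Do (Load 13 (Reg 13)),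
        Do (Op 13 Sub (Imm 1) (Reg 13)),
        Do (Op 11 Add (Reg 11) (Reg 13))]) (k' + 1) R' m'
       (\<lambda>k'' R'' m''. I k'' R'' m'' \<and> R'' 10 < R' 10) F (F R' m')"
      by (simp add: Q_def[abs_def] g_def F_def[of R'] j)
  qed simp
  then show ?thesis
  proof (rule triple_mono)
    show "ennreal (\<beta> ^ R' 11) \<le> F R' m'"
      if "\<exists>k0<k'. I k0 R' m' \<and> k' = k0 + 1 \<and> val (Reg 10) R' = 0" for k' R' m'
      using that by (auto simp: F_def)
    show "F R m \<le> ennreal (exp ((\<beta> - 1) * (degree_in E (alive m) v / B)))"
      using assms a_sum by (simp add: F_def j0_def del: of_nat_sum)
  qed (use assms j0_le in \<open>auto simp: I_def j0_def\<close>)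
qed

end

section \<open>Accuracy of the sampled degrees\<close>

context ram begin

lemma triple_cmult:
  assumes "triple p k R m Q F \<phi>"
  shows "triple p k R m Q (\<lambda>R m. a * F R m) (a * \<phi>)"
  using assms unfolding triple_def by (auto simp: nn_integral_cmult intro!: mult_left_mono)

end

context densest_run begin

text \<open>
  The estimate \<open>B * x\<close> of the degree \<open>d\<close> lies between \<open>(1 - \<delta>) d - \<delta> \<rho>\<close> and \<open>(1 + \<delta>) d + \<delta> \<rho>\<close>
  for \<open>\<delta> = 1 / q\<close>.
\<close>

definition accurate :: "nat set \<Rightarrow> nat \<Rightarrow> nat \<Rightarrow> bool" where
  "accurate S v x \<longleftrightarrow>
     real q * (real B * real x) \<le> (real q + 1) * real (degree_in E S v) + \<rho> \<and>
     (real q - 1) * real (degree_in E S v) - \<rho> \<le> real q * (real B * real x)"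

definition failure :: real where
  "failure = 2 * exp (- (real (c + 3) * real (floorlog 2 n)))"

lemma degree_sum_le_value: "real degree_sum \<le> 2 * \<rho> * real n"
proof -
  have "real degree_sum = (\<Sum>v<n. real (degree_in E {..<n} v))"
    unfolding degree_sum_def of_nat_sum
    by (intro sum.cong) (auto simp: length_incidence_list[OF simple incidence])
  then show ?thesis using sum_degree_in_le[of "{..<n}"] by simp
qed

lemma floorlog_pos: "floorlog 2 n > 0"
  using n_pos floorlog_eq_zero_iff[of 2 n] by simp

text \<open>For \<open>B = 1\<close> there is no lower bound on \<open>\<rho> / B\<close>, but then all counts are exact.\<close>

lemma failure_exponent:
  assumes "B \<noteq> 1"
  shows "real (c + 3) * real (floorlog 2 n) \<le> (1 / real q)\<^sup>2 * (\<rho> / real B) / 2"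
proof -
  let ?l = "floorlog 2 n"
  have "(B - 1) * (n * ?l * t) \<le> degree_sum"
    unfolding B_def by (simp add: div_times_less_eq_dividend)
  \<comment> \<open>\<open>B\<close> is at least 2 here, so undoing the rounded division costs a
    factor 2.\<close>
  moreover have "B * (n * ?l * t) \<le> 2 * (B - 1) * (n * ?l * t)"
    using assms B_pos by (intro mult_le_mono1) simp
  ultimately have "B * (n * ?l * t) \<le> 2 * degree_sum" by linarith
  then have "real B * (real n * real ?l * real t) \<le> 2 * real degree_sum"
    by (metis (mono_tags, lifting) of_nat_le_iff of_nat_mult of_nat_numeral)
  also have "\<dots> \<le> 4 * \<rho> * real n" using degree_sum_le_value by (simp add: mult_ac)
  finally have "real n * (real B * real ?l * real t) \<le> real n * (4 * \<rho>)" by (simp add: mult_ac)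
  then have *: "real B * real ?l * real t \<le> 4 * \<rho>" using n_pos by simp
  have "real t = 8 * (real q)\<^sup>2 * real (c + 3)"
    by (simp add: t_def sample_rate_def)
  then have "real (c + 3) * real ?l * (2 * (real q)\<^sup>2 * real B) \<le> \<rho>"
    using * by (simp add: algebra_simps)
  then show ?thesis
    using q_ge B_pos by (simp add: field_simps)
qed

lemma accurate_exact: "B = 1 \<Longrightarrow> accurate S v (degree_in E S v)"
  using value_nonneg q_ge by (simp add: accurate_def algebra_simps)

text \<open>Markov's inequality for both tails at once: if the count is inaccurate, one of two
  weighted moments is at least 1, and their expectations add up to at most
  \<open>failure\<close>.\<close>

lemma sample_accurate:
  assumes "v < n" "m n \<noteq> 0"
    and "R 3 = B" "R 8 = v" "R 14 = B - 1" "R 11 = 0" "R 10 = (length (inc v) + (B - 1)) div B"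
  shows "triple sample_prog k R m
     (\<lambda>k' R' m'. m' = m \<and> k' \<le> k + 9 * R 10 + 1 \<and> (\<forall>r. r \<notin> {10,11,12,13} \<longrightarrow> R' r = R r) \<and>
        R' 11 \<le> length (inc v))
     (\<lambda>R' m'. if accurate (alive m) v (R' 11) then 0 else 1) (ennreal failure)"
proof (cases "B = 1")
  case True
  show ?thesis
    by (rule triple_mono[OF triple_zero[OF sample_triple[where \<beta> = 1 and v = v]]])
       (use assms True in \<open>auto simp: accurate_exact[OF True, simplified]\<close>)
next
  case False
  define \<delta> where "\<delta> = 1 / real q"
  define \<mu> where "\<mu> = real (degree_in E (alive m) v) / real B"
  define \<nu> where "\<nu> = \<rho> / real B"
  have \<delta>: "0 < \<delta>" "\<delta> < 1" using q_ge by (auto simp: \<delta>_def)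
  have pos: "0 \<le> \<mu>" "0 \<le> \<nu>" using value_nonneg by (auto simp: \<mu>_def \<nu>_def)
  have expo: "real (c + 3) * real (floorlog 2 n) \<le> \<delta>\<^sup>2 * \<nu> / 2"
    using failure_exponent[OF False] by (simp add: \<delta>_def \<nu>_def)
  let ?Q = "\<lambda>k' R' m'. m' = m \<and> k' \<le> k + 9 * R 10 + 1 \<and> (\<forall>r. r \<notin> {10,11,12,13} \<longrightarrow> R' r = R r) \<and>
        R' 11 \<le> length (inc v) \<and> (B = 1 \<longrightarrow> R' 11 = degree_in E (alive m) v)"
  \<comment> \<open>The weights contain the inverse of the moment bound
    \<open>exp (\<plusminus> \<delta> * \<mu>)\<close>, so \<open>\<mu>\<close> drops out and each
    tail keeps \<open>exp (- (\<delta>\<^sup>2 * \<nu> / 2))\<close>.\<close>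
  define w1 where "w1 = ennreal (exp (- (\<delta> * \<mu> + \<delta>\<^sup>2 * \<nu> / 2)))"
  define w2 where "w2 = ennreal (exp (\<delta> * \<mu> - \<delta>\<^sup>2 * \<nu> / 2))"
  have 1: "triple sample_prog k R m ?Q (\<lambda>R' m'. w1 * ennreal ((1 + \<delta>) ^ R' 11))
      (w1 * ennreal (exp ((1 + \<delta> - 1) * \<mu>)))"
    unfolding \<mu>_def using assms \<delta> by (intro triple_cmult sample_triple) auto
  have 2: "triple sample_prog k R m ?Q (\<lambda>R' m'. w2 * ennreal ((1 - \<delta>) ^ R' 11))
      (w2 * ennreal (exp ((1 - \<delta> - 1) * \<mu>)))"
    unfolding \<mu>_def using assms \<delta> by (intro triple_cmult sample_triple) auto
  show ?thesis
  proof (rule triple_mono[OF triple_add[OF 1 2]])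
    fix k' :: nat and R' m' :: "nat \<Rightarrow> nat"
    let ?x = "R' 11"
    show "(if accurate (alive m) v ?x then 0 else 1) \<le>
        w1 * ennreal ((1 + \<delta>) ^ ?x) + w2 * ennreal ((1 - \<delta>) ^ ?x)"
    proof (cases "accurate (alive m) v ?x")
      case False
      have "?x > (1 + \<delta>) * \<mu> + \<delta> * \<nu> \<or> ?x < (1 - \<delta>) * \<mu> - \<delta> * \<nu>"
      proof (rule ccontr)
        assume "\<not> ?thesis"
        then have "real q * real B * ?x \<le> real q * real B * ((1 + \<delta>) * \<mu> + \<delta> * \<nu>)"
          "real q * real B * ((1 - \<delta>) * \<mu> - \<delta> * \<nu>) \<le> real q * real B * ?x"
          by (auto intro!: mult_left_mono)
        moreover have "real q * real B * ((1 + \<delta>) * \<mu> + \<delta> * \<nu>) =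
            (real q + 1) * real (degree_in E (alive m) v) + \<rho>"
          using q_ge B_pos by (simp add: \<delta>_def \<mu>_def \<nu>_def field_simps)
        moreover have "real q * real B * ((1 - \<delta>) * \<mu> - \<delta> * \<nu>) =
            (real q - 1) * real (degree_in E (alive m) v) - \<rho>"
          using q_ge B_pos by (simp add: \<delta>_def \<mu>_def \<nu>_def field_simps)
        ultimately show False using False by (simp add: accurate_def mult_ac)
      qed
      then show ?thesis
      proof
        assume "?x > (1 + \<delta>) * \<mu> + \<delta> * \<nu>"
        then have "1 \<le> ennreal (exp (- (\<delta> * \<mu> + \<delta>\<^sup>2 * \<nu> / 2)) * (1 + \<delta>) ^ ?x)"
          using upper_tail_weight[OF \<delta> pos] by (simp add: mult_ac)
        also have "\<dots> = w1 * ennreal ((1 + \<delta>) ^ ?x)"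
          unfolding w1_def by (rule ennreal_mult) (use \<delta> in auto)
        finally show ?thesis using False by (auto intro: add_increasing2)
      next
        assume "?x < (1 - \<delta>) * \<mu> - \<delta> * \<nu>"
        then have "1 \<le> ennreal (exp (\<delta> * \<mu> - \<delta>\<^sup>2 * \<nu> / 2) * (1 - \<delta>) ^ ?x)"
          using lower_tail_weight[OF \<delta> pos] by (simp add: mult_ac)
        also have "\<dots> = w2 * ennreal ((1 - \<delta>) ^ ?x)"
          unfolding w2_def by (rule ennreal_mult) (use \<delta> in auto)
        finally show ?thesis using False by (auto intro: add_increasing)
      qed
    qed simp
  next
    have "w1 * ennreal (exp ((1 + \<delta> - 1) * \<mu>)) = ennreal (exp (- (\<delta>\<^sup>2 * \<nu> / 2)))"
      unfolding w1_def by (simp add: ennreal_mult[symmetric] exp_add[symmetric] del: ennreal_mult)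
    moreover have "w2 * ennreal (exp ((1 - \<delta> - 1) * \<mu>)) = ennreal (exp (- (\<delta>\<^sup>2 * \<nu> / 2)))"
      unfolding w2_def by (simp add: ennreal_mult[symmetric] exp_add[symmetric] del: ennreal_mult)
    ultimately have "w1 * ennreal (exp ((1 + \<delta> - 1) * \<mu>)) + w2 * ennreal (exp ((1 - \<delta> - 1) * \<mu>)) =
        ennreal (2 * exp (- (\<delta>\<^sup>2 * \<nu> / 2)))"
      by (simp add: ennreal_plus[symmetric] del: ennreal_plus)
    also have "\<dots> \<le> ennreal failure"
      unfolding failure_def using expo by (intro ennreal_leI) simp
    finally show "w1 * ennreal (exp ((1 + \<delta> - 1) * \<mu>)) + w2 * ennreal (exp ((1 - \<delta> - 1) * \<mu>)) \<le>
        ennreal failure" .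
  qed auto
qed

end

section \<open>Counting all remaining vertices\<close>

context densest_run begin

text \<open>The 13 consists of four charges up to and including the branch, four to set up the
  sampling, one for its last test and four to store the result.\<close>

definition count_cost :: "nat \<Rightarrow> nat" where
  "count_cost v = 13 + 9 * ((length (inc v) + (B - 1)) div B)"

text \<open>Cells up to \<open>n\<close> are not written, so all vertices are judged against the
  same set. The union bound is a potential: visited vertices contribute an indicator, unvisited ones
  their budget \<open>failure\<close>.\<close>

lemma count_triple:
  assumes "m n \<noteq> 0" "R 0 = n" "R 3 = B" "R 14 = B - 1" "R 7 = 0" "R 8 = n"
  shows "triple count_prog k R m
     (\<lambda>k' R' m'. k' \<le> k + (\<Sum>v<n. count_cost v) + 1 \<and> (\<forall>r. r \<notin> {7..13} \<longrightarrow> R' r = R r) \<and>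
        (\<forall>x\<le>n. m' x = m x) \<and> R' 7 = (\<Sum>x\<in>alive m. m' (n + 1 + x)) \<and>
        (\<forall>x\<in>alive m. m' (n + 1 + x) \<le> length (inc x)))
     (\<lambda>R' m'. if \<forall>x\<in>alive m. accurate (alive m) x (m' (n + 1 + x)) then 0 else 1)
     (of_nat n * ennreal failure)"
proof -
  define S where "S = alive m"
  define G where "G v m' \<longleftrightarrow> (\<forall>x\<in>S. x \<ge> v \<longrightarrow> accurate S x (m' (n + 1 + x)))" for v m'
  define F where "F R m' = (if G (R 8) m' then 0 else 1) + of_nat (R 8) * ennreal failure"
    for R m' :: "nat \<Rightarrow> nat"
  define I where "I k' R' m' \<longleftrightarrow> R' 8 \<le> n \<and> k' + (\<Sum>v<R' 8. count_cost v) \<le> k + (\<Sum>v<n. count_cost v) \<and>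
     (\<forall>r. r \<notin> {7..13} \<longrightarrow> R' r = R r) \<and> (\<forall>x\<le>n. m' x = m x) \<and>
     R' 7 = (\<Sum>x\<in>{x\<in>S. x \<ge> R' 8}. m' (n + 1 + x)) \<and>
     (\<forall>x\<in>S. x \<ge> R' 8 \<longrightarrow> m' (n + 1 + x) \<le> length (inc x))" for k' R' m'
  have S: "S \<subseteq> {..<n}" "finite S" using alive_subset finite_alive by (auto simp: S_def)
  have M: "4 * n + B \<le> M" "16 * n + 16 \<le> M" using B_M M_ge_affine by auto
  have degree_sum_M: "degree_sum \<le> M"
    using degree_sum_le by (intro M_ge') (simp add: power2_eq_square power4_eq_xxxx algebra_simps)
  have "triple count_prog k R m (\<lambda>k' R' m'. \<exists>k0<k'. I k0 R' m' \<and> k' = k0 + 1 \<and> val (Reg 8) R' = 0) F (F R m)"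
    unfolding count_prog_def
  proof (rule triple_While[where V = "\<lambda>R m. R 8"])
    have "{x \<in> S. n \<le> x} = {}" using S by auto
    then show "I k R m"
      using assms S by (auto simp: I_def)
  next
    fix k' R' m'
    assume I: "I k' R' m'" and "val (Reg 8) R' \<noteq> 0"
    then obtain v where v: "R' 8 = Suc v" by (auto simp: gr0_conv_Suc)
    have R'[simp]: "R' 3 = B" "R' 14 = B - 1" "R' 0 = n" and m'n: "m' n \<noteq> 0"
      using I assms by (auto simp: I_def)
    have vn: "v < n" using I v by (simp add: I_def)
    have alive_eq: "alive m' = S" using I by (auto simp: I_def alive_def S_def)
    have Sv: "v \<in> S \<longleftrightarrow> m' v = 0" using alive_eq vn by (auto simp: alive_def)
    have len: "length (inc v) \<le> n" using vn by (rule length_le)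
    have deg: "degree_answer n inc v = length (inc v)" using vn by (simp add: degree_answer_def)
    define Q where "Q k'' R'' m'' \<longleftrightarrow> I k'' R'' m'' \<and> R'' 8 < R' 8" for k'' R'' m''
    define W where "W = (if G (Suc v) m' then 0 else 1) + of_nat v * ennreal failure"
    have FW: "F R' m' = ennreal failure + W"
      by (simp add: F_def W_def v algebra_simps)
    let ?rest = "block [
       Do (Op 12 Add (Reg 0) (Reg 8)),
       Do (Op 12 Add (Reg 12) (Imm 1)),
       Do (Store (Reg 12) (Reg 11)),
       Do (Op 7 Add (Reg 7) (Reg 11))]"
    have ge_split: "{x \<in> S. v \<le> x} = (if v \<in> S then insert v {x \<in> S. Suc v \<le> x} else {x \<in> S. Suc v \<le> x})"
      by (auto simp: Suc_le_eq order.order_iff_strict)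
    have cells: "Suc (n + v) < cells" using vn by (simp add: cells_def)
    have len_M: "length (inc v) + (B - 1) \<le> M" and one: "1 \<le> M" using len M by simp_all
    have skip: "Q (k' + 1 + 1 + 1 + 1) (R'(8 := v, 9 := m' v)) m'"
      "F (R'(8 := v, 9 := m' v)) m' \<le> F R' m'" if "m' v \<noteq> 0"
    proof -
      have "v \<notin> S" using that Sv by simp
      then have ge: "v \<le> x \<longleftrightarrow> Suc v \<le> x" if "x \<in> S" for x
        using that by (cases "x = v") auto
      then have ge_eq: "{x \<in> S. v \<le> x} = {x \<in> S. Suc v \<le> x}" by blast
      then show "Q (k' + 1 + 1 + 1 + 1) (R'(8 := v, 9 := m' v)) m'"
        using I v vn ge by (simp add: I_def Q_def count_cost_def ge_eq)
      have "G (Suc v) m' \<Longrightarrow> G v m'" using ge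
        by (simp add: G_def)
      then have "F (R'(8 := v, 9 := m' v)) m' \<le> W" by (simp add: F_def W_def)
      then show "F (R'(8 := v, 9 := m' v)) m' \<le> F R' m'"
        unfolding FW by (simp add: add_increasing)
    qed
    have rest: "triple (Seq ?rest Skip) k1 R1 m1 Q F ((if accurate S v (R1 11) then 0 else 1) + W)"
      if "v \<in> S" "m1 = m'" "k1 + (\<Sum>x<v. count_cost x) + 4 \<le> k + (\<Sum>x<n. count_cost x)"
        "\<forall>r. r \<notin> {9,10,11,12,13} \<longrightarrow> R1 r = (R'(8 := v)) r" "R1 11 \<le> length (inc v)" for k1 R1 m1
    proof -
      have [simp]: "R1 0 = n" "R1 8 = v" "R1 7 = R' 7" using that(4) by auto
      define m2 where "m2 = m'(Suc (n + v) := R1 11)"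
      define X where "X = (if accurate S v (R1 11) then 0 else 1) + W"
      have m2: "m2 (n + 1 + x) = (if x = v then R1 11 else m' (n + 1 + x))" for x
        by (simp add: m2_def)
      have sum: "R' 7 + R1 11 = (\<Sum>x\<in>{x\<in>S. x \<ge> v}. m2 (n + 1 + x))"
        using I v S that(1) unfolding ge_split m2 by (simp add: I_def Suc_le_eq)
      have len2: "\<forall>x\<in>S. x \<ge> v \<longrightarrow> m2 (n + 1 + x) \<le> length (inc x)"
        using I v that(5) unfolding m2 by (auto simp: I_def)
      have "(\<Sum>x\<in>{x\<in>S. x \<ge> v}. m2 (n + 1 + x)) \<le> (\<Sum>x\<in>{x\<in>S. x \<ge> v}. length (inc x))"
        using len2 by (intro sum_mono) auto
      also have "\<dots> \<le> degree_sum"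
        unfolding degree_sum_def using S by (intro sum_mono2) auto
      finally have sum_M: "R' 7 + R1 11 \<le> M" using degree_sum_M sum by simp
      have "G (Suc v) m' \<Longrightarrow> accurate S v (R1 11) \<Longrightarrow> G v m2"
        unfolding G_def m2 by (auto simp: Suc_le_eq)
      then have G: "(if G v m2 then 0 else 1) + of_nat v * ennreal failure \<le> (if accurate S v (R1 11) then 0 else 1) + W"
        by (auto simp: W_def add_increasing)
      have "I (k1 + 1 + 1 + 1 + 1) (R1(12 := Suc (n + v), 7 := R' 7 + R1 11)) m2"
        using I that(3,4) vn sum len2 by (auto simp: I_def m2_def)
      then have "Q (k1 + 1 + 1 + 1 + 1) (R1(12 := Suc (n + v), 7 := R' 7 + R1 11)) m2 \<and>
          F (R1(12 := Suc (n + v), 7 := R' 7 + R1 11)) m2 \<le> X"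
        using v G by (simp add: Q_def F_def X_def)
      then show ?thesis
        unfolding that(2) foldr.simps o_apply id_apply X_def[symmetric]
        using M vn sum_M
        apply -
        apply (rule triple_Seq_assoc)
        apply (rule triple_Op; (simp del: One_nat_def)?)
        apply (rule triple_Seq_assoc)
        apply (rule triple_Op; (simp)?)
        apply (rule triple_Seq_assoc)
        apply (rule triple_Store; (simp add: cells)?)
        apply (rule triple_Seq_assoc)
        apply (rule triple_Op; (simp)?)
        apply (rule triple_Skip_Seq)
        apply (rule triple_Skip)
        apply (simp_all add: m2_def)
        done
    qed
    show "triple (block [
     Do (Op 8 Sub (Reg 8) (Imm 1)),
     Do (Load 9 (Reg 8)),
     If (Reg 9) Skip (block [
       Do (Op 11 Add (Imm 0) (Imm 0)),
       Do (Degree 10 (Reg 8)),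
       Do (Op 10 Add (Reg 10) (Reg 14)),
       Do (Op 10 Div (Reg 10) (Reg 3)),
       sample_prog,
       Do (Op 12 Add (Reg 0) (Reg 8)),
       Do (Op 12 Add (Reg 12) (Imm 1)),
       Do (Store (Reg 12) (Reg 11)),
       Do (Op 7 Add (Reg 7) (Reg 11))])]) (k' + 1) R' m'
       (\<lambda>k'' R'' m''. I k'' R'' m'' \<and> R'' 8 < R' 8) F (F R' m')"
      unfolding Q_def[symmetric] foldr.simps o_apply id_apply
      apply (rule triple_Op; (simp add: v one del: One_nat_def)?)
      apply (rule triple_Load; (simp del: One_nat_def)?)
      apply (rule triple_If; (simp del: One_nat_def)?)
       apply (rule triple_Skip_Seq)
       apply (rule triple_Skip)
        apply (use skip in simp)
       apply (use skip in simp)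
      apply (rule triple_Seq_assoc)
      apply (rule triple_Op; (simp del: One_nat_def)?)
      apply (rule triple_Seq_assoc)
      apply (rule triple_Degree; (simp add: deg del: One_nat_def)?)
      apply (rule triple_Seq_assoc)
      apply (rule triple_Op; (simp add: len_M del: One_nat_def)?)
      apply (rule triple_Seq_assoc)
      apply (rule triple_Op; (simp del: One_nat_def)?)
      apply (rule triple_Seq_assoc)
      apply (rule triple_Seq)
       apply (subst FW)
       apply (rule triple_const)
       apply (rule sample_accurate[of v m', unfolded alive_eq]; (simp add: vn m'n)?)
      subgoal premises prems for k1 R1 m1
      proof (rule rest[unfolded foldr.simps o_apply id_apply])
        show "v \<in> S" using prems(1) Sv by simp
        show "k1 + (\<Sum>x<v. count_cost x) + 4 \<le> k + (\<Sum>x<n. count_cost x)"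
          using prems(2) I v by (simp add: I_def count_cost_def)
      qed (use prems(2) in auto)
      done
  qed simp
  then show ?thesis
  proof (rule triple_mono)
    show "(if \<forall>x\<in>alive m. accurate (alive m) x (m' (n + 1 + x)) then 0 else 1) \<le> F R' m'"
      if "\<exists>k0<k'. I k0 R' m' \<and> k' = k0 + 1 \<and> val (Reg 8) R' = 0" for k' R' m'
      using that by (auto simp: F_def G_def S_def)
    have "G n m" using S by (auto simp: G_def)
    then show "F R m \<le> of_nat n * ennreal failure"
      using assms by (simp add: F_def)
  qed (auto simp: I_def S_def)
qed

end

context ram begin

text \<open>For pieces without random draws, where everything follows from the sure postcondition: a
  pointwise bound on \<open>F\<close> then bounds its expectation.\<close>

lemma triple_sure:
  assumes "triple p k R m Q (\<lambda>_ _. 0) 0"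
    and "\<And>k R m. Q k R m \<Longrightarrow> Q' k R m \<and> F R m \<le> \<phi>"
  shows "triple p k R m Q' F \<phi>"
  by (rule triple_mono[OF triple_const[OF assms(1), of \<phi>]]) (use assms(2) in auto)

end

section \<open>Removing the vertices with small counts\<close>

context densest_run begin

text \<open>All decisions depend on the counts and on registers 9 and 13, none of which the loop
  writes, so marking vertices one after the other has the effect of a simultaneous deletion.\<close>

lemma remove_triple:
  assumes "m n \<noteq> 0" "R 0 = n" "R 8 = n" "R 4 = card (alive m)"
    and bound: "\<And>x. x \<in> alive m \<Longrightarrow> m (n + 1 + x) * R 9 \<le> M"
  shows "triple remove_prog k R m
     (\<lambda>k' R' m'. k' \<le> k + 12 * n + 1 \<and> (\<forall>r. r \<notin> {4,8,12} \<longrightarrow> R' r = R r) \<and> m' n = m n \<and>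
        alive m' = {x \<in> alive m. m (n + 1 + x) * R 9 > R 13} \<and> R' 4 = card (alive m'))
     (\<lambda>_ _. 0) 0"
proof -
  define D where "D = {x \<in> alive m. m (n + 1 + x) * R 9 \<le> R 13}"
  define I where "I k' R' m' \<longleftrightarrow> R' 8 \<le> n \<and> k' + 12 * R' 8 \<le> k + 12 * n \<and>
     (\<forall>r. r \<notin> {4,8,12} \<longrightarrow> R' r = R r) \<and> m' = (\<lambda>x. if x \<in> D \<and> x \<ge> R' 8 then 1 else m x) \<and>
     R' 4 = card (alive m')" for k' R' m'
  have D: "D \<subseteq> alive m" "D \<subseteq> {..<n}" using alive_subset by (auto simp: D_def)
  have M: "16 * n + 16 \<le> M" using M_ge_affine by auto
  have "triple remove_prog k R m (\<lambda>k' R' m'. \<exists>k0<k'. I k0 R' m' \<and> k' = k0 + 1 \<and> val (Reg 8) R' = 0)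
      (\<lambda>_ _. 0) 0"
    unfolding remove_prog_def
  proof (rule triple_While[where V = "\<lambda>R m. R 8" and F = "\<lambda>_ _. 0"])
    have "m = (\<lambda>x. if x \<in> D \<and> x \<ge> n then 1 else m x)" by (rule ext) (use D(2) in auto)
    then show "I k R m"
      using assms by (auto simp: I_def)
  next
    fix k' R' m'
    assume I: "I k' R' m'" and "val (Reg 8) R' \<noteq> 0"
    then obtain v where v: "R' 8 = Suc v" by (auto simp: gr0_conv_Suc)
    have vn: "v < n" using I v by (simp add: I_def)
    have R'[simp]: "R' 0 = n" "R' 9 = R 9" "R' 13 = R 13"
      using I assms by (auto simp: I_def)
    have m'[simp]: "m' v = m v" "m' (Suc (n + v)) = m (n + 1 + v)"
      using I v D(2) by (auto simp: I_def)
    have alive_v: "v \<in> alive m' \<longleftrightarrow> m v = 0" "v \<in> alive m \<longleftrightarrow> m v = 0"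
      using vn m'(1) by (auto simp: alive_def)
    have bound_v: "m v = 0 \<Longrightarrow> m (Suc (n + v)) * R 9 \<le> M" using bound[of v] alive_v by simp
    have D_v: "v \<in> D \<longleftrightarrow> m v = 0 \<and> m (n + 1 + v) * R 9 \<le> R 13"
      using alive_v by (auto simp: D_def)
    define Q where "Q k'' R'' m'' \<longleftrightarrow> I k'' R'' m'' \<and> R'' 8 < R' 8" for k'' R'' m''
    have Q_keep: "Q k'' R'' m'"
      if "v \<notin> D" "k'' \<le> k' + 12" "\<forall>r. r \<notin> {8, 12} \<longrightarrow> R'' r = R' r" "R'' 8 = v" for k'' R''
    proof -
      have "x \<in> D \<and> v \<le> x \<longleftrightarrow> x \<in> D \<and> Suc v \<le> x" for x
        using that(1) by (cases "x = v") auto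
      then show ?thesis using I that(2-4) v by (simp add: I_def Q_def)
    qed
    have Q_remove: "Q k'' R'' (m'(v := 1))"
      if "v \<in> D" "k'' \<le> k' + 12" "\<forall>r. r \<notin> {4, 8, 12} \<longrightarrow> R'' r = R' r" "R'' 8 = v" "R'' 4 = R' 4 - 1" for k'' R''
    proof -
      have "m'(v := 1) = (\<lambda>x. if x \<in> D \<and> x \<ge> v then 1 else m x)"
        using I v that(1) by (auto simp: I_def fun_eq_iff le_Suc_eq Suc_le_eq)
      moreover have "alive (m'(v := 1)) = alive m' - {v}" by (auto simp: alive_def)
      then have "card (alive (m'(v := 1))) = R' 4 - 1"
        using I alive_v D_v that(1) by (simp add: I_def)
      ultimately show ?thesis using I that(2-5) v by (simp add: I_def Q_def)
    qed
    have cells: "v < cells" using vn by (simp add: cells_def)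
    have "m (Suc (n + v)) * R 9 - R 13 = 0 \<longleftrightarrow> m (Suc (n + v)) * R 9 \<le> R 13" by simp
    then show "triple (block [
     Do (Op 8 Sub (Reg 8) (Imm 1)),
     Do (Load 12 (Reg 8)),
     If (Reg 12) Skip (block [
       Do (Op 12 Add (Reg 0) (Reg 8)),
       Do (Op 12 Add (Reg 12) (Imm 1)),
       Do (Load 12 (Reg 12)),
       Do (Op 12 Mul (Reg 12) (Reg 9)),
       Do (Op 12 Sub (Reg 12) (Reg 13)),
       If (Reg 12) Skip (block [
         Do (Store (Reg 8) (Imm 1)),
         Do (Op 4 Sub (Reg 4) (Imm 1))])])]) (k' + 1) R' m'
       (\<lambda>k'' R'' m''. I k'' R'' m'' \<and> R'' 8 < R' 8) (\<lambda>_ _. 0) 0"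
      unfolding Q_def[symmetric] foldr.simps o_apply id_apply
      using M vn
      apply -
      apply (rule triple_Op; (simp add: v)?)
      apply (rule triple_Load; (simp)?)
      apply (rule triple_If; (simp)?)
       apply (rule triple_Skip_Seq)
       apply (rule triple_Skip)
        apply (rule Q_keep; (simp add: D_v)?)
       apply simp
      apply (rule triple_Seq_assoc)
      apply (rule triple_Op; (simp)?)
      apply (rule triple_Seq_assoc)
      apply (rule triple_Op; (simp)?)
      apply (rule triple_Seq_assoc)
      apply (rule triple_Load; (simp)?)
      apply (rule triple_Seq_assoc)
      apply (rule triple_Op; (simp add: bound_v)?)
      apply (rule triple_Seq_assoc)
      apply (rule triple_Op; (simp)?)
      apply (rule triple_Seq_assoc)
      apply (rule triple_If; (simp)?)
       apply (rule triple_Skip_Seq)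
       apply (rule triple_Skip_Seq)
       apply (rule triple_Skip)
        apply (rule Q_keep; (simp add: D_v)?)
       apply simp
      apply (rule triple_Seq_assoc)
      apply (rule triple_Store; (simp add: cells)?)
      apply (rule triple_Seq_assoc)
      apply (rule triple_Op; (simp)?)
      apply (rule triple_Skip_Seq)
      apply (rule triple_Skip_Seq)
      apply (rule triple_Skip)
       apply (rule Q_remove[unfolded One_nat_def]; (simp add: D_v)?)
      apply simp
      done
  qed auto
  then show ?thesis
  proof (rule triple_mono)
    fix k' R' m'
    assume "\<exists>k0<k'. I k0 R' m' \<and> k' = k0 + 1 \<and> val (Reg 8) R' = 0"
    then obtain k0 where I: "I k0 R' m'" "k' = k0 + 1" "R' 8 = 0" by auto
    then have m': "m' = (\<lambda>x. if x \<in> D then 1 else m x)" by (simp add: I_def)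
    then have "alive m' = alive m - D" by (auto simp: alive_def)
    also have "\<dots> = {x \<in> alive m. m (n + 1 + x) * R 9 > R 13}"
      by (simp only: D_def set_eq_iff mem_Collect_eq Diff_iff) (simp add: not_le, blast)
    finally have "alive m' = {x \<in> alive m. m (n + 1 + x) * R 9 > R 13}" .
    moreover have "n \<notin> D" using D(2) by auto
    then have "m' n = m n" by (simp add: m')
    ultimately show "k' \<le> k + 12 * n + 1 \<and> (\<forall>r. r \<notin> {4,8,12} \<longrightarrow> R' r = R r) \<and> m' n = m n \<and>
        alive m' = {x \<in> alive m. m (n + 1 + x) * R 9 > R 13} \<and> R' 4 = card (alive m')"
      using I by (auto simp: I_def)
  qed auto
qed

end

section \<open>One pass\<close>

context densest_run begin

text \<open>\<open>B * a / b\<close> estimates an average degree. Relative to \<open>\<rho>\<close>,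
  the lower estimate with its additive error leaves \<open>(q - 2) / q\<close>, and the deletion
  threshold costs \<open>(q + 1) / q\<close>.\<close>

definition dense_witness :: "nat \<Rightarrow> nat \<Rightarrow> bool" where
  "dense_witness a b \<longleftrightarrow> (real q - 2) * \<rho> * real b \<le> (real q + 1) * real B * real a"

text \<open>\<open>S0\<close> stands for an optimal set: it is still intact, or a dense set has been
  recorded. Once nothing remains, only the witness is possible. The second conjunct guards against
  overestimates; \<open>2 * (q + 2)\<close> matches the denominator of the output.\<close>

definition good :: "nat set \<Rightarrow> nat set \<Rightarrow> nat \<Rightarrow> nat \<Rightarrow> bool" where
  "good S0 S a b \<longleftrightarrow> (S0 \<subseteq> S \<or> dense_witness a b) \<and>
     real q * real B * real a \<le> 2 * (real q + 2) * \<rho> * real b"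

lemma dense_witness_mono:
  assumes "dense_witness a b" "a * b' \<le> a' * b" "b > 0"
  shows "dense_witness a' b'"
proof -
  have "real b * ((real q - 2) * \<rho> * real b') = (real q - 2) * \<rho> * real b * real b'" by (simp add: mult_ac)
  also have "\<dots> \<le> (real q + 1) * real B * real a * real b'"
    using assms(1) unfolding dense_witness_def by (intro mult_right_mono) auto
  also have "\<dots> = (real q + 1) * real B * real (a * b')" by simp
  also have "\<dots> \<le> (real q + 1) * real B * real (a' * b)"
    using assms(2) by (intro mult_left_mono of_nat_mono) auto
  also have "\<dots> = real b * ((real q + 1) * real B * real a')" by simp
  finally show ?thesis using assms(3) by (simp add: dense_witness_def)
qed

text \<open>Markov's inequality: each survivor has a count well above the average.\<close>

lemma card_survivors:
  fixes x :: "nat \<Rightarrow> nat"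
  assumes "finite S" "S \<noteq> {}" "S' = {v \<in> S. (\<Sum>v\<in>S. x v) * (q + 1) < x v * (card S * q)}"
  shows "card S' * (q + 1) < card S * q"
proof (cases "S' = {}")
  case True
  then show ?thesis using assms(1,2) q_ge by (simp add: card_gt_0_iff)
next
  case False
  let ?t = "\<Sum>v\<in>S. x v"
  have "finite S'" using assms(1,3) by simp
  then have "(\<Sum>v\<in>S'. ?t * (q + 1)) < (\<Sum>v\<in>S'. x v * (card S * q))"
    by (intro sum_strict_mono) (use False assms(3) in auto)
  also have "\<dots> = (\<Sum>v\<in>S'. x v) * (card S * q)" by (simp add: sum_distrib_right)
  also have "\<dots> \<le> ?t * (card S * q)"
    using assms(1,3) by (intro mult_le_mono1 sum_mono2) auto
  finally have "?t * (card S' * (q + 1)) < ?t * (card S * q)" by (simp only: sum_constant of_nat_id mult_ac)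
  then show ?thesis by simp
qed

lemma good_step:
  fixes x :: "nat \<Rightarrow> nat"
  assumes S: "S \<subseteq> {..<n}" "S \<noteq> {}" and b: "b > 0"
    and S': "S' = {v \<in> S. (\<Sum>v\<in>S. x v) * (q + 1) < x v * (card S * q)}"
    and S0: "S0 \<subseteq> {..<n}" "\<And>v. v \<in> S0 \<Longrightarrow> \<rho> \<le> real (degree_in E S0 v)"
    and acc: "\<And>v. v \<in> S \<Longrightarrow> accurate S v (x v)"
    and "good S0 S a b"
    and best: "(a', b') = (if a * card S < (\<Sum>v\<in>S. x v) * b then (\<Sum>v\<in>S. x v, card S) else (a, b))"
  shows "good S0 S' a' b'"
proof -
  let ?t = "\<Sum>v\<in>S. x v"
  have fin: "finite S" using S(1) finite_subset by blast
  have s: "card S > 0" using S fin by (simp add: card_gt_0_iff)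
  \<comment> \<open>Summing the upper estimates gives \<open>2 * (q + 1) + 1\<close> times
    \<open>\<rho> * card S\<close>, rounded up to \<open>2 * (q + 2)\<close>.\<close>
  have "real q * real B * real ?t = (\<Sum>v\<in>S. real q * (real B * real (x v)))"
    unfolding of_nat_sum sum_distrib_left by (simp add: mult_ac)
  also have "\<dots> \<le> (\<Sum>v\<in>S. (real q + 1) * real (degree_in E S v) + \<rho>)"
    using acc by (intro sum_mono) (simp add: accurate_def)
  also have "\<dots> = (real q + 1) * (\<Sum>v\<in>S. real (degree_in E S v)) + \<rho> * real (card S)"
    by (simp add: sum.distrib sum_distrib_left)
  also have "\<dots> \<le> (real q + 1) * (2 * \<rho> * real (card S)) + \<rho> * real (card S)"
    using sum_degree_in_le[OF S(1)] by (intro add_right_mono mult_left_mono) auto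
  also have "\<dots> \<le> 2 * (real q + 2) * \<rho> * real (card S)"
    using value_nonneg by (simp add: algebra_simps)
  finally have up: "real q * real B * real ?t \<le> 2 * (real q + 2) * \<rho> * real (card S)" .
  have better: "a * b' \<le> a' * b" "?t * b' \<le> a' * card S"
    using best by (auto split: if_splits)
  have "S0 \<subseteq> S' \<or> dense_witness a' b'"
  proof (cases "dense_witness a b")
    case True
    then show ?thesis using dense_witness_mono[OF True better(1) b] by simp
  next
    case False
    then have sub: "S0 \<subseteq> S" using assms(8) by (simp add: good_def)
    show ?thesis
    proof (cases "S0 \<subseteq> S'")
      case False
      then obtain v where v: "v \<in> S0" "v \<notin> S'" by blast
      then have vS: "v \<in> S" using sub by blast
      have removed: "x v * (card S * q) \<le> ?t * (q + 1)" using v(2) vS S' by simp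
      have "degree_in E S0 v \<le> degree_in E S v" by (rule degree_in_mono[OF sub fin])
      then have "\<rho> \<le> real (degree_in E S v)" using S0(2)[OF v(1)] by linarith
      then have "(real q - 1) * \<rho> \<le> (real q - 1) * real (degree_in E S v)"
        using q_ge by (intro mult_left_mono) auto
      then have "(real q - 2) * \<rho> \<le> real q * (real B * real (x v))"
        using acc[OF vS] by (simp add: accurate_def algebra_simps)
      then have "(real q - 2) * \<rho> * real (card S) \<le> real q * (real B * real (x v)) * real (card S)"
        by (rule mult_right_mono) simp
      also have "\<dots> = real B * real (x v * (card S * q))" by simp
      also have "\<dots> \<le> real B * real (?t * (q + 1))"
        using removed by (intro mult_left_mono of_nat_mono) auto
      also have "\<dots> = (real q + 1) * real B * real ?t" by (simp add: algebra_simps del: of_nat_sum)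
      finally have "dense_witness ?t (card S)" by (simp only: dense_witness_def)
      then show ?thesis using dense_witness_mono better(2) s by blast
    qed simp
  qed
  moreover have "real q * real B * real a' \<le> 2 * (real q + 2) * \<rho> * real b'"
    using best up assms(8) by (auto simp: good_def split: if_splits)
  ultimately show ?thesis by (simp add: good_def)
qed

definition pass_cost :: nat where
  "pass_cost = (\<Sum>v<n. count_cost v) + 12 * n + 15"

text \<open>The part of the loop invariant that holds for all samples, however inaccurate. The
  bounds on registers 5 and 6 exclude overflow.\<close>

definition pass_inv :: "(nat \<Rightarrow> nat) \<Rightarrow> (nat \<Rightarrow> nat) \<Rightarrow> bool" where
  "pass_inv R m \<longleftrightarrow> m n \<noteq> 0 \<and> R 0 = n \<and> R 3 = B \<and> R 14 = B - 1 \<and> R 4 = card (alive m) \<and>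
     R 5 \<le> n\<^sup>2 \<and> 0 < R 6 \<and> R 6 \<le> n"

lemma cube_M: "n\<^sup>2 * n \<le> M"
  by (intro M_ge') (simp add: power2_eq_square power4_eq_xxxx algebra_simps)

lemma square_M: "x \<le> t \<Longrightarrow> n\<^sup>2 * x \<le> M"
  using M_ge[of x "n\<^sup>2"] by (simp add: power2_eq_square power4_eq_xxxx algebra_simps)

text \<open>After a pass \<open>good\<close> can fail for two reasons only: it failed before, or one
  of at most \<open>n\<close> fresh counts is inaccurate.\<close>

lemma pass_triple:
  assumes inv: "pass_inv R m" and "R 4 > 0"
    and S0: "S0 \<subseteq> {..<n}" "\<And>v. v \<in> S0 \<Longrightarrow> \<rho> \<le> real (degree_in E S0 v)"
  shows "triple (pass_prog q) k R m
     (\<lambda>k' R' m'. k' \<le> k + pass_cost \<and> pass_inv R' m' \<and> R' 4 * (q + 1) < R 4 * q)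
     (\<lambda>R' m'. if good S0 (alive m') (R' 5) (R' 6) then 0 else 1)
     ((if good S0 (alive m) (R 5) (R 6) then 0 else 1) + of_nat n * ennreal failure)"
proof -
  define Q where "Q k' R' m' \<longleftrightarrow> k' \<le> k + pass_cost \<and> pass_inv R' m' \<and> R' 4 * (q + 1) < R 4 * q" for k' R' m'
  define F where "F R' m' = (if good S0 (alive m') (R' 5) (R' 6) then 0 else (1 :: ennreal))" for R' m' :: "nat \<Rightarrow> nat"
  define S where "S = alive m"
  define w where "w = (if good S0 S (R 5) (R 6) then 0 else (1 :: ennreal))"
  have [simp]: "m n \<noteq> 0" "R 0 = n" "R 3 = B" "R 14 = B - 1" "R 4 = card S"
    using inv by (auto simp: pass_inv_def S_def)
  have S: "S \<subseteq> {..<n}" "finite S" "S \<noteq> {}" "card S \<le> n"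
    using assms(2) alive_subset finite_alive[of m] card_mono[OF _ alive_subset[of m]] by (auto simp: S_def)
  have R56: "R 5 \<le> n\<^sup>2" "0 < R 6" "R 6 \<le> n" using inv by (auto simp: pass_inv_def)
  have rest: "triple (block [
     Do (Op 12 Mul (Reg 7) (Reg 6)),
     Do (Op 13 Mul (Reg 5) (Reg 4)),
     Do (Op 12 Sub (Reg 12) (Reg 13)),
     If (Reg 12) (block [
       Do (Op 5 Add (Reg 7) (Imm 0)),
       Do (Op 6 Add (Reg 4) (Imm 0))]) Skip,
     Do (Op 9 Mul (Reg 4) (Imm q)),
     Do (Op 13 Mul (Reg 7) (Imm (q + 1))),
     Do (Op 8 Add (Reg 0) (Imm 0)),
     remove_prog]) k1 R1 m1 Q F
       ((if \<forall>x\<in>S. accurate S x (m1 (n + 1 + x)) then 0 else 1) + w)"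
    if k1: "k1 \<le> k + (\<Sum>v<n. count_cost v) + 3" and R1: "\<forall>r. r \<notin> {7..13} \<longrightarrow> R1 r = R r"
      and m1: "\<forall>x\<le>n. m1 x = m x" and tot: "R1 7 = (\<Sum>x\<in>S. m1 (n + 1 + x))"
      and len: "\<forall>x\<in>S. m1 (n + 1 + x) \<le> length (inc x)" for k1 R1 m1
  proof -
    define x where "x v = m1 (n + 1 + v)" for v
    define X where "X = (if \<forall>v\<in>S. accurate S v (x v) then 0 else 1) + w"
    have [simp]: "R1 0 = n" "R1 3 = B" "R1 14 = B - 1" "R1 4 = card S" "R1 5 = R 5" "R1 6 = R 6"
      using R1 by auto
    have "R1 7 \<le> (\<Sum>v\<in>S. length (inc v))" unfolding tot using len by (intro sum_mono) auto
    also have "\<dots> \<le> degree_sum" unfolding degree_sum_def using S by (intro sum_mono2) auto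
    finally have t_le: "R1 7 \<le> n\<^sup>2" using degree_sum_le by simp
    have alive1: "alive m1 = S" using m1 by (auto simp: alive_def S_def)
    have "R1 7 * R 6 \<le> n\<^sup>2 * n" "R 5 * card S \<le> n\<^sup>2 * n" "R1 7 * (q + 1) \<le> n\<^sup>2 * (q + 1)"
      using t_le R56 S(4) by (blast intro: mult_le_mono order_refl)+
    then have bounds: "R1 7 * R 6 \<le> M" "R 5 * card S \<le> M" "R1 7 * (q + 1) \<le> M"
      using cube_M square_M[of "q + 1"] t_ge by linarith+
    have n_sq: "n \<le> n\<^sup>2" by (simp add: power2_eq_square)
    have "card S * q \<le> n\<^sup>2 * q" using S(4) n_sq by (intro mult_le_mono1) linarith
    then have sq_M: "card S * q \<le> M" using square_M[of q] t_ge by linarith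
    have "n\<^sup>2 \<le> M" using square_M[of 1] t_ge by simp
    then have M: "q \<le> M" "q + 1 \<le> M" "R1 7 \<le> M" "card S \<le> M" "R 5 \<le> M" "n \<le> M" "0 \<le> M"
      using t_ge M_ge[of t 1] S(4) t_le R56 M_ge_affine by auto
    have tail: "triple (block [
       Do (Op 9 Mul (Reg 4) (Imm q)),
       Do (Op 13 Mul (Reg 7) (Imm (q + 1))),
       Do (Op 8 Add (Reg 0) (Imm 0)),
       remove_prog]) k2 R2 m1 Q F X"
      if k2: "k2 \<le> k1 + 6" and R2: "\<forall>r. r \<notin> {5, 6, 12, 13} \<longrightarrow> R2 r = R1 r"
        and best: "(R2 5, R2 6) = (if R 5 * card S < R1 7 * R 6 then (R1 7, card S) else (R 5, R 6))" for k2 R2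
    proof -
      have [simp]: "R2 0 = n" "R2 3 = B" "R2 14 = B - 1" "R2 4 = card S" "R2 7 = R1 7"
        using R2 by auto
      define R3 where "R3 = R2(9 := card S * q, 13 := R1 7 * (q + 1), 8 := n)"
      have "triple remove_prog (k2 + 1 + 1 + 1) R3 m1 Q F X"
      proof (rule triple_sure[OF remove_triple])
        show "m1 n \<noteq> 0" "R3 0 = n" "R3 8 = n" "R3 4 = card (alive m1)"
          using m1 alive1 by (auto simp: R3_def)
        fix v assume "v \<in> alive m1"
        then have "m1 (n + 1 + v) \<le> n" using len length_le[of v] S(1) alive1 by fastforce
        then have "m1 (n + 1 + v) * (card S * q) \<le> n * (n * q)"
          using S(4) by (intro mult_le_mono) auto
        also have "\<dots> = n\<^sup>2 * q" by (simp add: power2_eq_square)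
        also have "\<dots> \<le> M" using square_M[of q] t_ge by simp
        finally show "m1 (n + 1 + v) * R3 9 \<le> M" by (simp add: R3_def)
      next
        fix k' R' m'
        assume *: "k' \<le> k2 + 1 + 1 + 1 + 12 * n + 1 \<and> (\<forall>r. r \<notin> {4,8,12} \<longrightarrow> R' r = R3 r) \<and> m' n = m1 n \<and>
          alive m' = {v \<in> alive m1. m1 (n + 1 + v) * R3 9 > R3 13} \<and> R' 4 = card (alive m')"
        then have alive': "alive m' = {v \<in> S. (\<Sum>v\<in>S. x v) * (q + 1) < x v * (card S * q)}"
          unfolding alive1 x_def tot[symmetric] by (simp add: R3_def)
        have R'56: "(R' 5, R' 6) = (if R 5 * card S < (\<Sum>v\<in>S. x v) * R 6 then (\<Sum>v\<in>S. x v, card S) else (R 5, R 6))"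
          using * best unfolding x_def tot[symmetric] by (simp add: R3_def)
        have "pass_inv R' m'"
          using * m1 R56 S(2-4) t_le R'56 unfolding x_def tot[symmetric]
          by (auto simp: pass_inv_def R3_def card_gt_0_iff split: if_splits)
        moreover have "R' 4 * (q + 1) < R 4 * q"
          using * card_survivors[OF S(2,3) alive'] by simp
        moreover have "F R' m' \<le> X"
        proof (cases "(\<forall>v\<in>S. accurate S v (x v)) \<and> good S0 S (R 5) (R 6)")
          case True
          then have "good S0 (alive m') (R' 5) (R' 6)"
            using R56 S0 by (intro good_step[OF S(1,3) _ alive' _ _ _ _ R'56]) auto
          then show ?thesis by (simp add: F_def)
        next
          case False
          then show ?thesis by (auto simp: F_def X_def w_def)
        qed
        ultimately show "Q k' R' m' \<and> F R' m' \<le> X"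
          using * k1 k2 by (simp add: Q_def pass_cost_def)
      qed
      then show ?thesis
        unfolding foldr.simps o_apply id_apply R3_def
        using bounds sq_M M
        apply -
        apply (rule triple_Op; (simp del: add_mult_distrib2 mult_Suc_right)?)
        apply (rule triple_Op; simp?)
        apply (rule triple_Op; simp?)
        apply (erule triple_Seq)
        apply (rule triple_Skip)
         apply simp_all
        done
    qed
    show ?thesis
      unfolding X_def[symmetric, unfolded x_def] foldr.simps o_apply id_apply
      using bounds M
      apply -
      apply (rule triple_Op; simp?)
      apply (rule triple_Op; simp?)
      apply (rule triple_Op; simp?)
      apply (rule triple_If; simp?)
       apply (rule triple_Seq_assoc)
       apply (rule triple_Op; simp?)
       apply (rule triple_Seq_assoc)
       apply (rule triple_Op; simp?)
       apply (rule triple_Skip_Seq)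
       apply (rule tail[unfolded foldr.simps o_apply id_apply, simplified]; simp)
      apply (rule triple_Skip_Seq)
      apply (rule tail[unfolded foldr.simps o_apply id_apply, simplified]; simp)
      done
  qed
  have "triple (pass_prog q) k R m Q F (w + of_nat n * ennreal failure)"
    unfolding pass_prog_def foldr.simps o_apply id_apply
    using M_ge_affine
    apply -
    apply (rule triple_Op; (simp del: One_nat_def)?)
    apply (rule triple_Op; (simp del: One_nat_def)?)
    apply (rule triple_Seq)
     apply (subst add.commute[of w])
     apply (rule triple_const)
     apply (rule count_triple; (simp del: S_def)?)
    subgoal premises prems for k1 R1 m1
      using prems by (intro rest[unfolded foldr.simps o_apply id_apply S_def]) auto
    done
  then show ?thesis
    unfolding w_def S_def Q_def[abs_def] F_def[abs_def] by blast
qed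

end

section \<open>The main loop\<close>

context densest_run begin

lemma floorlog_le_self: "floorlog 2 n \<le> n"
  by (rule floorlog_leI) auto

lemma floorlog_half: "x > 0 \<Longrightarrow> floorlog 2 x = Suc (floorlog 2 (x div 2))"
  by (subst compute_floorlog) simp

lemma log_triple:
  assumes "R 9 = n" "R 1 = 0"
  shows "triple log_prog k R m
     (\<lambda>k' R' m'. k' \<le> k + 3 * floorlog 2 n + 1 \<and> (\<forall>r. r \<notin> {1, 9} \<longrightarrow> R' r = R r) \<and> m' = m \<and>
        R' 1 = floorlog 2 n) (\<lambda>_ _. 0) 0"
proof -
  define I where "I k' R' m' \<longleftrightarrow> k' + 3 * floorlog 2 (R' 9) \<le> k + 3 * floorlog 2 n \<and>
     (\<forall>r. r \<notin> {1, 9} \<longrightarrow> R' r = R r) \<and> m' = m \<and> R' 1 + floorlog 2 (R' 9) = floorlog 2 n" for k' R' m'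
  have "triple log_prog k R m (\<lambda>k' R' m'. \<exists>k0<k'. I k0 R' m' \<and> k' = k0 + 1 \<and> val (Reg 9) R' = 0) (\<lambda>_ _. 0) 0"
    unfolding log_prog_def
  proof (rule triple_While[where V = "\<lambda>R m. R 9" and F = "\<lambda>_ _. 0"])
    show "I k R m" using assms by (simp add: I_def)
    fix k' R' m'
    assume I: "I k' R' m'" and "val (Reg 9) R' \<noteq> 0"
    then have pos: "R' 9 > 0" by simp
    define Q where "Q k'' R'' m'' \<longleftrightarrow> I k'' R'' m'' \<and> R'' 9 < R' 9" for k'' R'' m''
    have M: "Suc (R' 1) \<le> M" "2 \<le> M" "1 \<le> M"
      using I floorlog_half[OF pos] floorlog_le_self M_ge_affine by (auto simp: I_def)
    have "Q (k' + 1 + 1 + 1) (R'(1 := Suc (R' 1), 9 := R' 9 div 2)) m'"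
      using I pos floorlog_half[OF pos] by (auto simp: I_def Q_def)
    then show "triple (block [Do (Op 1 Add (Reg 1) (Imm 1)), Do (Op 9 Div (Reg 9) (Imm 2))]) (k' + 1) R' m'
       (\<lambda>k'' R'' m''. I k'' R'' m'' \<and> R'' 9 < R' 9) (\<lambda>_ _. 0) 0"
      unfolding Q_def[symmetric] foldr.simps o_apply id_apply
      using M
      apply -
      apply (rule triple_Op; simp?)
      apply (rule triple_Op; simp?)
      apply (rule triple_Skip; simp)
      done
  qed simp
  then show ?thesis
    by (rule triple_mono) (auto simp: I_def floorlog_def)
qed

lemma degree_sum_triple:
  assumes "R 8 = n" "R 2 = 0"
  shows "triple degree_sum_prog k R m
     (\<lambda>k' R' m'. k' \<le> k + 4 * n + 1 \<and> (\<forall>r. r \<notin> {2, 8, 9} \<longrightarrow> R' r = R r) \<and> m' = m \<and>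
        R' 2 = degree_sum) (\<lambda>_ _. 0) 0"
proof -
  define I where "I k' R' m' \<longleftrightarrow> R' 8 \<le> n \<and> k' + 4 * R' 8 \<le> k + 4 * n \<and>
     (\<forall>r. r \<notin> {2, 8, 9} \<longrightarrow> R' r = R r) \<and> m' = m \<and>
     R' 2 + (\<Sum>v<R' 8. length (inc v)) = degree_sum" for k' R' m'
  have "triple degree_sum_prog k R m (\<lambda>k' R' m'. \<exists>k0<k'. I k0 R' m' \<and> k' = k0 + 1 \<and> val (Reg 8) R' = 0)
      (\<lambda>_ _. 0) 0"
    unfolding degree_sum_prog_def
  proof (rule triple_While[where V = "\<lambda>R m. R 8" and F = "\<lambda>_ _. 0"])
    show "I k R m" using assms by (simp add: I_def degree_sum_def)
    fix k' R' m'
    assume I: "I k' R' m'" and "val (Reg 8) R' \<noteq> 0"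
    then obtain v where v: "R' 8 = Suc v" by (auto simp: gr0_conv_Suc)
    define Q where "Q k'' R'' m'' \<longleftrightarrow> I k'' R'' m'' \<and> R'' 8 < R' 8" for k'' R'' m''
    have deg: "degree_answer n inc v = length (inc v)"
      using I v by (simp add: I_def degree_answer_def)
    have "degree_sum \<le> M" using degree_sum_le square_M[of 1] t_ge by simp
    then have M: "R' 2 + length (inc v) \<le> M" "1 \<le> M"
      using I v M_ge_affine by (auto simp: I_def)
    have "Q (k' + 1 + 1 + 1 + 1) (R'(8 := v, 9 := length (inc v), 2 := R' 2 + length (inc v))) m'"
      using I v by (auto simp: I_def Q_def)
    then show "triple (block [
       Do (Op 8 Sub (Reg 8) (Imm 1)),
       Do (Degree 9 (Reg 8)),
       Do (Op 2 Add (Reg 2) (Reg 9))]) (k' + 1) R' m'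
       (\<lambda>k'' R'' m''. I k'' R'' m'' \<and> R'' 8 < R' 8) (\<lambda>_ _. 0) 0"
      unfolding Q_def[symmetric] foldr.simps o_apply id_apply
      using M
      apply -
      apply (rule triple_Op; (simp add: v)?)
      apply (rule triple_Degree; (simp add: deg)?)
      apply (rule triple_Op; simp?)
      apply (rule triple_Skip; simp)
      done
  qed simp
  then show ?thesis
    by (rule triple_mono) (auto simp: I_def)
qed

text \<open>A pass divides the number of alive vertices by more than \<open>1 + 1 / q\<close>.\<close>

definition passes :: "nat \<Rightarrow> real" where
  "passes s = (if s = 0 then 0 else 1 + (real q + 1) * ln (real s))"

text \<open>\<open>ln (q / (q + 1)) <= - 1 / (q + 1)\<close>, so a pass lowers
  \<open>(q + 1) * ln s\<close> by at least 1. The extra 1 in \<open>passes\<close> pays for the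
  pass that removes the last vertices, where no logarithm is left.\<close>

lemma passes_less:
  assumes "s' * (q + 1) < s * q"
  shows "passes s' + 1 \<le> passes s"
proof (cases "s' = 0")
  case True
  then show ?thesis using assms by (auto simp: passes_def)
next
  case False
  have s: "s > 0" using assms by (cases s) auto
  have less: "real s' * (real q + 1) \<le> real s * real q"
    using assms by (metis less_imp_le of_nat_1 of_nat_add of_nat_le_iff of_nat_mult)
  have "real s' \<le> real s * (real q / (real q + 1))"
    using less by (simp add: field_simps)
  then have "ln (real s') \<le> ln (real s * (real q / (real q + 1)))"
    using False by (intro ln_mono) auto
  also have "\<dots> = ln (real s) + ln (real q / (real q + 1))"
    using s q_ge by (intro ln_mult_pos) auto
  also have "ln (real q / (real q + 1)) \<le> real q / (real q + 1) - 1"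
    using q_ge by (intro ln_le_minus_one) auto
  also have "\<dots> = - (1 / (real q + 1))" by (simp add: field_simps)
  finally have "(real q + 1) * ln (real s') \<le> (real q + 1) * (ln (real s) - 1 / (real q + 1))"
    by (intro mult_left_mono) auto
  also have "\<dots> = (real q + 1) * ln (real s) - 1" by (simp add: field_simps)
  finally show ?thesis using False s by (simp add: passes_def)
qed

text \<open>Passes are counted in two ways. The cost uses the logarithmic \<open>passes\<close>; the
  failure budget uses the number of alive vertices, since a pass removes at least one. The latter is
  cruder, but it is the content of register 4, and the extra power of \<open>n\<close> is paid for
  by the sample rate.\<close>

lemma main_loop_triple:
  assumes inv: "pass_inv R m"
    and S0: "S0 \<subseteq> {..<n}" "\<And>v. v \<in> S0 \<Longrightarrow> \<rho> \<le> real (degree_in E S0 v)"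
    and good: "good S0 (alive m) (R 5) (R 6)"
  shows "triple (While (Reg 4) (pass_prog q)) k R m
     (\<lambda>k' R' m'. real k' \<le> real k + (real pass_cost + 1) * passes n + 1 \<and> pass_inv R' m' \<and> R' 4 = 0)
     (\<lambda>R' m'. if good S0 {} (R' 5) (R' 6) then 0 else 1)
     (of_nat n * (of_nat n * ennreal failure))"
proof -
  define f where "f = of_nat n * ennreal failure"
  define F where "F R m = (if good S0 (alive m) (R 5) (R 6) then 0 else 1) + of_nat (R 4) * f"
    for R m :: "nat \<Rightarrow> nat"
  define I where "I k' R' m' \<longleftrightarrow> pass_inv R' m' \<and>
     real k' + (real pass_cost + 1) * passes (R' 4) \<le> real k + (real pass_cost + 1) * passes (R 4)" for k' R' m'
  have R4: "R 4 \<le> n"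
    using inv card_mono[OF _ alive_subset[of m]] by (simp add: pass_inv_def)
  have passes_zero: "passes 0 = 0" by (simp add: passes_def)
  have passes_le: "passes (R 4) \<le> passes n"
    using R4 n_pos by (auto simp: passes_def intro!: mult_left_mono add_nonneg_nonneg)
  have "triple (While (Reg 4) (pass_prog q)) k R m
      (\<lambda>k' R' m'. \<exists>k0<k'. I k0 R' m' \<and> k' = k0 + 1 \<and> val (Reg 4) R' = 0) F (F R m)"
  proof (rule triple_While[where V = "\<lambda>R m. R 4"])
    show "I k R m" using inv by (simp add: I_def)
    fix k' R' m'
    assume I: "I k' R' m'" and "val (Reg 4) R' \<noteq> 0"
    then obtain s where s: "R' 4 = Suc s" by (auto simp: gr0_conv_Suc)
    have *: "triple (pass_prog q) (k' + 1) R' m'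
       (\<lambda>k'' R'' m''. k'' \<le> k' + 1 + pass_cost \<and> pass_inv R'' m'' \<and> R'' 4 * (q + 1) < R' 4 * q)
       (\<lambda>R'' m''. (if good S0 (alive m'') (R'' 5) (R'' 6) then 0 else 1) + of_nat s * f)
       (((if good S0 (alive m') (R' 5) (R' 6) then 0 else 1) + f) + of_nat s * f)"
      unfolding f_def using I s S0 by (intro triple_const pass_triple) (auto simp: I_def)
    show "triple (pass_prog q) (k' + 1) R' m'
       (\<lambda>k'' R'' m''. I k'' R'' m'' \<and> R'' 4 < R' 4) F (F R' m')"
    proof (rule triple_mono[OF *])
      fix k'' R'' m''
      assume **: "k'' \<le> k' + 1 + pass_cost \<and> pass_inv R'' m'' \<and> R'' 4 * (q + 1) < R' 4 * q"
      have "R'' 4 * q \<le> R'' 4 * (q + 1)" by simp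
      then have "R'' 4 * q < R' 4 * q" using ** by linarith
      then have less: "R'' 4 < R' 4" by simp
      have "(real pass_cost + 1) * (passes (R'' 4) + 1) \<le> (real pass_cost + 1) * passes (R' 4)"
        using passes_less ** by (intro mult_left_mono) auto
      then show "I k'' R'' m'' \<and> R'' 4 < R' 4"
        using ** less I by (auto simp: I_def algebra_simps)
      have "of_nat (R'' 4) * f \<le> of_nat s * f"
        using less s by (intro mult_right_mono) auto
      then show "F R'' m'' \<le> (if good S0 (alive m'') (R'' 5) (R'' 6) then 0 else 1) + of_nat s * f"
        unfolding F_def by (rule add_left_mono)
    next
      show "((if good S0 (alive m') (R' 5) (R' 6) then 0 else 1) + f) + of_nat s * f \<le> F R' m'"
        by (simp add: F_def s distrib_right add_ac)
    qed
  qed simp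
  then show ?thesis
  proof (rule triple_mono)
    fix k' R' m'
    assume "\<exists>k0<k'. I k0 R' m' \<and> k' = k0 + 1 \<and> val (Reg 4) R' = 0"
    then obtain k0 where I: "I k0 R' m'" "k' = k0 + 1" "R' 4 = 0" by auto
    have "real k0 \<le> real k + (real pass_cost + 1) * passes (R 4)"
      using I by (simp add: I_def passes_zero)
    also have "(real pass_cost + 1) * passes (R 4) \<le> (real pass_cost + 1) * passes n"
      using passes_le by (intro mult_left_mono) auto
    finally show "real k' \<le> real k + (real pass_cost + 1) * passes n + 1 \<and> pass_inv R' m' \<and> R' 4 = 0"
      using I by (simp add: I_def)
    have "alive m' = {}" using I finite_alive[of m'] by (auto simp: I_def pass_inv_def)
    then show "(if good S0 {} (R' 5) (R' 6) then 0 else 1) \<le> F R' m'" by (simp add: F_def)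
  next
    show "F R m \<le> of_nat n * (of_nat n * ennreal failure)"
      using good R4 by (auto simp: F_def f_def intro!: mult_right_mono)
  qed
qed

definition total_cost :: real where
  "total_cost = real (3 * floorlog 2 n + 4 * n + 17) + (real pass_cost + 1) * passes n"

lemma densest_prog_triple:
  assumes S0: "S0 \<subseteq> {..<n}" "\<And>v. v \<in> S0 \<Longrightarrow> \<rho> \<le> real (degree_in E S0 v)"
  shows "triple (densest_prog c q) 1 ((\<lambda>_. 0)(0 := n)) (\<lambda>_. 0)
     (\<lambda>k' R' m'. real k' \<le> total_cost)
     (\<lambda>R' m'. if \<exists>a b. good S0 {} a b \<and> 0 < b \<and> R' 0 = B * a * q \<and> R' 1 = b * (2 * (q + 2)) then 0 else 1)
     (of_nat n * (of_nat n * ennreal failure))"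
proof -
  let ?l = "floorlog 2 n"
  define Q :: "nat \<Rightarrow> (nat \<Rightarrow> nat) \<Rightarrow> (nat \<Rightarrow> nat) \<Rightarrow> bool" where "Q k' R' m' \<longleftrightarrow> real k' \<le> total_cost" for k' R' m'
  define F :: "(nat \<Rightarrow> nat) \<Rightarrow> (nat \<Rightarrow> nat) \<Rightarrow> ennreal" where
    "F R' m' = (if \<exists>a b. good S0 {} a b \<and> 0 < b \<and> R' 0 = B * a * q \<and> R' 1 = b * (2 * (q + 2)) then 0 else 1)"
    for R' m'
  define \<phi> where "\<phi> = of_nat n * (of_nat n * ennreal failure)"
  have M1: "n \<le> M" "0 \<le> M" "1 \<le> M" and t_M: "t \<le> M" using M_ge_affine M_ge[of t 1] by auto
  have result: "triple (block [
     Do (Op 0 Mul (Reg 3) (Reg 5)),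
     Do (Op 0 Mul (Reg 0) (Imm q)),
     Do (Op 1 Mul (Reg 6) (Imm (2 * (q + 2))))]) k R m Q F (if good S0 {} (R 5) (R 6) then 0 else 1)"
    if "pass_inv R m" "real (k + 3) \<le> total_cost" for k R m
  proof -
    define X where "X = (if good S0 {} (R 5) (R 6) then 0 else (1 :: ennreal))"
    have R: "R 3 = B" "R 5 \<le> n\<^sup>2" "0 < R 6" "R 6 \<le> n" using that(1) by (auto simp: pass_inv_def)
    have "B * R 5 \<le> (n\<^sup>2 + 1) * n\<^sup>2" using B_le R by (intro mult_le_mono)
    also have "\<dots> \<le> (n + 2) ^ 4" by (simp add: power2_eq_square power4_eq_xxxx algebra_simps)
    finally have "q * (B * R 5) \<le> M" "B * R 5 \<le> M" using M_ge[of q "B * R 5"] M_ge'[of "B * R 5"] t_ge by auto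
    moreover have "2 * (q + 2) * R 6 \<le> M"
    proof (rule M_ge)
      have "n * 1 \<le> (n + 2) * (n + 2) ^ 3" by (intro mult_le_mono) auto
      then show "R 6 \<le> (n + 2) ^ 4" using R by (simp add: eval_nat_numeral)
    qed (rule t_ge)
    ultimately have M: "B * R 5 \<le> M" "B * R 5 * q \<le> M" "R 6 * (2 * (q + 2)) \<le> M" "q \<le> M" "2 * (q + 2) \<le> M"
      using t_ge t_M by (auto simp: mult_ac)
    have "\<exists>a b. good S0 {} a b \<and> 0 < b \<and> B * R 5 * q = B * a * q \<and> R 6 * (2 * (q + 2)) = b * (2 * (q + 2))"
      if "good S0 {} (R 5) (R 6)"
      using R that by blast
    then have "F (R(0 := B * R 5 * q, 1 := R 6 * (2 * (q + 2)))) m \<le> X"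
      by (simp add: F_def X_def)
    moreover have "Q (k + 1 + 1 + 1) (R(0 := B * R 5 * q, 1 := R 6 * (2 * (q + 2)))) m"
      using that(2) by (simp add: Q_def)
    ultimately show ?thesis
      unfolding X_def[symmetric] foldr.simps o_apply id_apply
      using M R(1)
      apply -
      apply (rule triple_Op; simp?)
      apply (rule triple_Op; simp?)
      apply (rule triple_Op; simp?)
      apply (rule triple_Skip; simp)
      done
  qed
  have main: "triple (block [
     Do (Op 9 Mul (Reg 0) (Reg 1)),
     Do (Op 9 Mul (Reg 9) (Imm t)),
     Do (Op 14 Div (Reg 2) (Reg 9)),
     Do (Op 3 Add (Reg 14) (Imm 1)),
     Do (Store (Reg 0) (Imm 1)),
     Do (Op 4 Add (Reg 0) (Imm 0)),
     Do (Op 6 Add (Imm 1) (Imm 0)),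
     While (Reg 4) (pass_prog q),
     Do (Op 0 Mul (Reg 3) (Reg 5)),
     Do (Op 0 Mul (Reg 0) (Imm q)),
     Do (Op 1 Mul (Reg 6) (Imm (2 * (q + 2))))]) k R (\<lambda>_. 0) Q F \<phi>"
    if k: "k \<le> 3 * ?l + 4 * n + 5" and R: "R 0 = n" "R 1 = ?l" "R 2 = degree_sum" "R 5 = 0" for k R
  proof -
    define R' where "R' = R(9 := n * ?l * t, 14 := B - 1, 3 := B, 4 := n, 6 := 1)"
    define m' :: "nat \<Rightarrow> nat" where "m' = (\<lambda>_. 0)(n := 1)"
    have alive: "alive m' = {..<n}" by (auto simp: alive_def m'_def)
    have inv: "pass_inv R' m'"
      using R n_pos by (auto simp: pass_inv_def alive) (auto simp: R'_def m'_def)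
    \<comment> \<open>The initial best pair is 0 over 1, which overestimates nothing.\<close>
    have "good S0 (alive m') (R' 5) (R' 6)"
      using S0 R value_nonneg by (auto simp: good_def alive R'_def)
    note loop = main_loop_triple[OF inv S0 this, folded \<phi>_def, of "k + 1 + 1 + 1 + 1 + 1 + 1 + 1"]
    have nl: "n * ?l \<le> n\<^sup>2" using floorlog_le_self by (simp add: power2_eq_square)
    then have M: "n * ?l \<le> M" "n * ?l * t \<le> M"
      using square_M[of 1] t_ge le_trans[OF mult_le_mono1[OF nl, of t] square_M[of t]] by simp_all
    have B: "Suc (degree_sum div (n * ?l * t)) = B" "degree_sum div (n * ?l * t) = B - 1" "B \<le> M"
      using B_M by (auto simp: B_def)
    have cells: "n < cells" by (simp add: cells_def)
    show ?thesis
      unfolding foldr.simps o_apply id_apply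
      using M B cells R M1 t_M
      apply -
      apply (rule triple_Op; simp?)
      apply (rule triple_Op; simp?)
      apply (rule triple_Op; simp?)
      apply (rule triple_Op; simp?)
      apply (rule triple_Store; simp?)
      apply (rule triple_Op; simp?)
      apply (rule triple_Op; simp?)
      apply (rule triple_Seq)
       apply (rule loop[unfolded R'_def m'_def One_nat_def add_Suc_right add_0_right])
       apply assumption
      subgoal premises prems for k' R'' m''
      proof -
        have "real (k' + 3) \<le> total_cost" using prems k by (simp add: total_cost_def)
        then show ?thesis
          using result[unfolded foldr.simps o_apply id_apply, of R'' m'' k'] prems by simp
      qed
      done
  qed
  have "triple (densest_prog c q) 1 ((\<lambda>_. 0)(0 := n)) (\<lambda>_. 0) Q F \<phi>"
    unfolding densest_prog_def t_def[symmetric] foldr.simps o_apply id_apply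
    using M1
    apply -
    apply (rule triple_Op; simp?)
    apply (rule triple_Seq)
     apply (rule triple_sure[OF log_triple, where Q' = "\<lambda>k' R' m'. k' \<le> 3 * ?l + 3 \<and> m' = (\<lambda>_. 0) \<and>
         R' 0 = n \<and> R' 1 = ?l \<and> R' 2 = 0 \<and> R' 5 = 0" and F = "\<lambda>_ _. \<phi>"])
       apply simp
      apply simp
     apply simp
    apply (elim conjE)
    apply (rule triple_Op; simp?)
    apply (rule triple_Seq)
     apply (rule triple_sure[OF degree_sum_triple, where Q' = "\<lambda>k' R' m'. k' \<le> 3 * ?l + 4 * n + 5 \<and> m' = (\<lambda>_. 0) \<and>
         R' 0 = n \<and> R' 1 = ?l \<and> R' 2 = degree_sum \<and> R' 5 = 0" and F = "\<lambda>_ _. \<phi>"])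
       apply simp
      apply simp
     apply simp
    subgoal premises prems for k R m k' R' m'
      using main[unfolded foldr.simps o_apply id_apply, of k' R'] prems by simp
    done
  then show ?thesis
    unfolding Q_def[abs_def] F_def[abs_def] \<phi>_def .
qed

text \<open>The two parts of \<open>good\<close> together lose the factor
  \<open>2 * (q + 1) * (q + 2) / (q * (q - 2))\<close>, about \<open>2 + 10 / q\<close>;
  \<open>16 <= \<epsilon> * q\<close> keeps it below \<open>2 + \<epsilon>\<close>.\<close>

lemma good_output:
  assumes "good S0 {} a b" "S0 \<noteq> {}" "0 < b" "16 \<le> \<epsilon> * real q"
  shows "approx_solution (2 + \<epsilon>) {..<n} E (real (B * a * q) / real (b * (2 * (q + 2))))"
proof -
  let ?x = "real q * real B * real a"
  have q: "real q \<ge> 17" using q_ge by simp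
  have eps: "\<epsilon> > 0" using assms(4) q by (smt (verit) mult_nonpos_nonneg)
  have up: "?x \<le> 2 * (real q + 2) * \<rho> * real b"
    and low: "(real q - 2) * \<rho> * real b \<le> (real q + 1) * real B * real a"
    using assms(1,2) by (auto simp: good_def dense_witness_def)
  have "16 * (real q - 2) \<le> \<epsilon> * real q * (real q - 2)"
    using assms(4) q by (intro mult_right_mono) auto
  then have coef: "2 * (real q + 1) * (real q + 2) \<le> (2 + \<epsilon>) * real q * (real q - 2)"
    using q by (simp add: algebra_simps)
  have "(real q + 1) * (2 * (real q + 2) * \<rho> * real b) = (2 * (real q + 1) * (real q + 2)) * (\<rho> * real b)"
    by (simp add: algebra_simps)
  also have "\<dots> \<le> ((2 + \<epsilon>) * real q * (real q - 2)) * (\<rho> * real b)"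
    using coef value_nonneg by (intro mult_right_mono) auto
  also have "\<dots> = (2 + \<epsilon>) * real q * ((real q - 2) * \<rho> * real b)" by (simp add: mult_ac)
  also have "\<dots> \<le> (2 + \<epsilon>) * real q * ((real q + 1) * real B * real a)"
    using low eps q by (intro mult_left_mono) auto
  also have "\<dots> = (real q + 1) * ((2 + \<epsilon>) * ?x)" by (simp add: mult_ac)
  finally have low': "2 * (real q + 2) * \<rho> * real b \<le> (2 + \<epsilon>) * ?x" by simp
  have eq: "real (B * a * q) / real (b * (2 * (q + 2))) = ?x / (2 * (real q + 2) * real b)"
    by (simp add: algebra_simps)
  have pos: "2 * (real q + 2) * real b > 0" using assms(3) by simp
  have "?x / (2 * (real q + 2) * real b) \<le> \<rho>"
    using up pos by (subst pos_divide_le_eq) (simp_all add: mult_ac)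
  moreover have "\<rho> / (2 + \<epsilon>) \<le> ?x / (2 * (real q + 2) * real b)"
    using low' pos eps assms(3) by (subst frac_le_eq) (auto simp: divide_le_0_iff mult_ac)
  ultimately show ?thesis unfolding approx_solution_def eq by simp
qed

end

section \<open>Resource bounds and the theorem\<close>

context densest_run begin

lemma n_less_power: "n < 2 ^ floorlog 2 n"
  using floorlog_bounds[of n 2] n_pos by simp

lemma ln_n_le: "ln (real n) \<le> real (floorlog 2 n)"
proof -
  have "real n \<le> 2 ^ floorlog 2 n"
    using n_less_power by (metis less_imp_le of_nat_le_iff of_nat_numeral of_nat_power)
  also have "\<dots> \<le> exp 1 ^ floorlog 2 n"
    using exp_ge_add_one_self[of 1] by (intro power_mono) auto
  also have "\<dots> = exp (real (floorlog 2 n))" by (simp flip: exp_of_nat_mult)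
  finally have "ln (real n) \<le> ln (exp (real (floorlog 2 n)))"
    using n_pos by (intro ln_mono) auto
  then show ?thesis by simp
qed

lemma one_le_product: "1 \<le> real n * real (floorlog 2 n) * real t"
proof -
  have "1 \<le> n * floorlog 2 n * t" using n_pos floorlog_pos t_ge by (simp add: Suc_le_eq)
  then show ?thesis by (metis of_nat_1 of_nat_le_iff of_nat_mult)
qed

text \<open>Rounding up costs at most one block per vertex; the other blocks number at most
  \<open>degree_sum / B\<close>, which the choice of \<open>B\<close> keeps below
  \<open>n * floorlog 2 n * t\<close>.\<close>

lemma pass_cost_le: "real pass_cost + 1 \<le> 59 * (real n * real (floorlog 2 n) * real t)"
proof -
  let ?X = "n * floorlog 2 n * t"
  have X: "?X > 0" using n_pos floorlog_pos t_ge by simp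
  have "degree_sum < B * ?X"
    using dividend_less_div_times[OF X, of degree_sum] by (simp add: B_def algebra_simps)
  then have D: "real degree_sum \<le> real B * real ?X"
    by (metis less_imp_le of_nat_le_iff of_nat_mult)
  have blocks: "real ((d + (B - 1)) div B) \<le> real d / real B + 1" for d
  proof -
    have "real ((d + (B - 1)) div B * B) \<le> real (d + B)"
      using blocks_cover(2) of_nat_le_iff by blast
    then show ?thesis using B_pos by (simp add: field_simps)
  qed
  have "real (\<Sum>v<n. count_cost v) = (\<Sum>v<n. 13 + 9 * real ((length (inc v) + (B - 1)) div B))"
    by (simp add: count_cost_def)
  also have "\<dots> \<le> (\<Sum>v<n. 13 + 9 * (real (length (inc v)) / real B + 1))"
    by (intro sum_mono add_left_mono mult_left_mono blocks) simp
  also have "\<dots> = 22 * real n + 9 * (real degree_sum / real B)"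
    by (simp add: sum.distrib sum_divide_distrib sum_distrib_left degree_sum_def algebra_simps)
  also have "real degree_sum / real B \<le> real ?X"
    using D B_pos by (simp add: field_simps)
  finally have "real pass_cost + 1 \<le> 34 * real n + 16 + 9 * real ?X"
    by (simp add: pass_cost_def)
  moreover have "n * 1 \<le> n * (floorlog 2 n * t)"
    using floorlog_pos t_ge by (intro mult_le_mono2) (simp add: Suc_le_eq)
  then have "real n \<le> real ?X" by (simp only: of_nat_le_iff mult_1_right mult.assoc)
  moreover have "1 \<le> real ?X" using one_le_product by simp
  ultimately have "real pass_cost + 1 \<le> 59 * real ?X" by linarith
  then show ?thesis by simp
qed

lemma passes_le: "passes n \<le> (real q + 2) * real (floorlog 2 n)"
proof -
  have "(real q + 1) * ln (real n) \<le> (real q + 1) * real (floorlog 2 n)"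
    using ln_n_le by (intro mult_left_mono) auto
  moreover have "1 \<le> real (floorlog 2 n)" using floorlog_pos by (simp add: Suc_le_eq)
  ultimately show ?thesis using n_pos by (simp add: passes_def algebra_simps)
qed

lemma total_cost_le: "total_cost \<le> 100 * real n * real (floorlog 2 n) ^ 2 * real t * (real q + 2)"
proof -
  let ?l = "real (floorlog 2 n)"
  let ?Y = "real n * ?l * real t * ((real q + 2) * ?l)"
  have l: "1 \<le> ?l" and n: "1 \<le> real n" and t: "1 \<le> real t"
    using floorlog_pos n_pos t_ge by (auto simp: Suc_le_eq)
  have "(real pass_cost + 1) * passes n \<le> 59 * (real n * ?l * real t) * ((real q + 2) * ?l)"
    using pass_cost_le passes_le n_pos
    by (intro mult_mono) (auto simp: passes_def intro!: add_nonneg_nonneg mult_nonneg_nonneg)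
  then have "(real pass_cost + 1) * passes n \<le> 59 * ?Y" by (simp add: mult_ac)
  moreover have "?l \<le> ?Y" "real n \<le> ?Y" "1 \<le> ?Y"
  proof -
    have q: "1 \<le> (real q + 2) * ?l" using l mult_mono[of 1 "real q + 2" 1 ?l] by simp
    have "1 * 1 * 1 \<le> real n * ?l * real t" using l n t by (intro mult_mono) auto
    then show "1 \<le> ?Y" using q mult_mono[of 1 "real n * ?l * real t" 1 "(real q + 2) * ?l"] by simp
    have "1 * ?l * 1 \<le> real n * ?l * real t" using l n t by (intro mult_mono) auto
    then show "?l \<le> ?Y" using q l mult_mono[of ?l "real n * ?l * real t" 1 "(real q + 2) * ?l"] by simp
    have "real n * 1 * 1 \<le> real n * ?l * real t" using l n t by (intro mult_mono) auto
    then show "real n \<le> ?Y" using q n mult_mono[of "real n" "real n * ?l * real t" 1 "(real q + 2) * ?l"] by simp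
  qed
  ultimately have "total_cost \<le> 100 * ?Y" by (simp add: total_cost_def)
  then show ?thesis by (simp add: power2_eq_square mult_ac)
qed

text \<open>The crude \<open>t < 2 ^ t\<close> replaces the logarithm of \<open>t\<close> by
  \<open>t\<close> itself, which only raises the power of \<open>1 / \<epsilon>\<close>.\<close>

lemma floorlog_M_le: "real (1 + 3 * floorlog 2 M) \<le> 5 * real t * real (floorlog 2 n)"
proof -
  let ?l = "floorlog 2 n"
  have "n + 2 \<le> 2 ^ ?l + 1" using n_less_power by simp
  also have "\<dots> \<le> 2 ^ (?l + 1)" by simp
  finally have "(n + 2) ^ 4 \<le> (2 ^ (?l + 1)) ^ 4" by (rule power_mono) simp
  moreover have "t < 2 ^ t" by (rule less_exp)
  ultimately have "M < 2 ^ t * (2 ^ (?l + 1)) ^ 4"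
    unfolding M_def by (intro mult_less_le_imp_less) auto
  also have "\<dots> = 2 ^ (t + 4 * (?l + 1))" by (simp add: power_add power_mult[symmetric] mult_ac)
  finally have *: "floorlog 2 M \<le> t + 4 * (?l + 1)" by (intro floorlog_leI) auto
  define x where "x = t * ?l"
  have "t \<le> x" "16 * ?l \<le> x"
    using floorlog_pos t_ge by (auto simp: x_def)
  have "1 + 3 * floorlog 2 M \<le> 3 * t + (12 * ?l + 13)" using * by simp
  also have "\<dots> \<le> 3 * x + 32 * ?l" using \<open>t \<le> x\<close> floorlog_pos by (intro add_mono) auto
  also have "\<dots> \<le> 5 * x" using \<open>16 * ?l \<le> x\<close> by simp
  finally have "1 + 3 * floorlog 2 M \<le> 5 * x" .
  then have "1 + 3 * floorlog 2 M \<le> 5 * (t * ?l)"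
    unfolding x_def .
  then show ?thesis by (metis (mono_tags, lifting) mult.assoc of_nat_le_iff of_nat_mult of_nat_numeral)
qed

definition resource_bound :: real where
  "resource_bound = 500 * real n * real (floorlog 2 n) ^ 3 * real t ^ 2 * (real q + 2)"

lemma charged_le:
  assumes "charged k s" "real k \<le> total_cost"
  shows "real (time s) \<le> resource_bound" "real (queries s) \<le> resource_bound"
    "real (peak s) \<le> resource_bound"
proof -
  let ?l = "real (floorlog 2 n)"
  have l: "1 \<le> ?l" and n: "1 \<le> real n" and t: "1 \<le> real t"
    using floorlog_pos n_pos t_ge by (auto simp: Suc_le_eq)
  have k: "real k \<le> 100 * real n * ?l ^ 2 * real t * (real q + 2)"
    using assms(2) total_cost_le by linarith
  have tl: "1 \<le> 5 * real t * ?l" using l t mult_mono[of 1 "real t" 1 ?l] by simp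
  have bound: "(100 * real n * ?l ^ 2 * real t * (real q + 2)) * (5 * real t * ?l) = resource_bound"
    by (simp add: resource_bound_def power2_eq_square power3_eq_cube mult_ac)
  have "real (time s) \<le> real k * real (1 + 3 * floorlog 2 M)"
    using assms(1) unfolding charged_def by (metis of_nat_le_iff of_nat_mult)
  also have "\<dots> \<le> (100 * real n * ?l ^ 2 * real t * (real q + 2)) * (5 * real t * ?l)"
    using k floorlog_M_le by (intro mult_mono) auto
  finally show "real (time s) \<le> resource_bound" unfolding bound .
  have "real (queries s) \<le> real k * 1" using assms(1) by (simp add: charged_def)
  also have "\<dots> \<le> (100 * real n * ?l ^ 2 * real t * (real q + 2)) * (5 * real t * ?l)"
    using k tl by (intro mult_mono) auto
  finally show "real (queries s) \<le> resource_bound" unfolding bound .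
  have "peak s \<le> (15 + cells) * (1 + 2 * floorlog 2 M)" using assms(1) by (simp add: charged_def)
  also have "\<dots> \<le> (19 * n) * (1 + 3 * floorlog 2 M)"
    using n_pos by (intro mult_le_mono) (auto simp: cells_def)
  finally have "real (peak s) \<le> real (19 * n) * real (1 + 3 * floorlog 2 M)"
    by (metis of_nat_le_iff of_nat_mult)
  also have "\<dots> \<le> (100 * real n * ?l ^ 2 * real t * (real q + 2)) * (5 * real t * ?l)"
  proof (rule mult_mono[OF _ floorlog_M_le])
    have "19 * real n * 1 * 1 * 1 \<le> 100 * real n * ?l ^ 2 * real t * (real q + 2)"
      using l n t by (intro mult_mono) (auto simp: one_le_power)
    then show "real (19 * n) \<le> 100 * real n * ?l ^ 2 * real t * (real q + 2)" by simp
  qed auto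
  finally show "real (peak s) \<le> resource_bound" unfolding bound .
qed

text \<open>\<open>t\<close> is of order \<open>1 / \<epsilon>\<^sup>2\<close> and enters squared,
  and \<open>q\<close> adds one more power: this is the exponent 5. The cubed logarithm is raised to
  it because \<open>near_linear\<close> has a single exponent. The constants are
  \<open>76000 = 500 * 2 ^ 3 * 19\<close> and \<open>2312 = 8 * 17\<^sup>2\<close>.\<close>

lemma resource_bound_le:
  assumes "0 < \<epsilon>" "real q \<le> 17 / \<epsilon>" "\<epsilon> < 1"
  shows "resource_bound \<le> near_linear (76000 * (2312 * (real c + 3))\<^sup>2) 5 \<epsilon> n"
proof -
  let ?l = "real (floorlog 2 n)"
  define x where "x = log 2 (real n + 1)"
  have x: "1 \<le> x" using n_pos by (simp add: x_def le_log_iff)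
  have "?l \<le> log 2 (real n) + 1"
    using n_pos by (simp add: floorlog_def)
  also have "log 2 (real n) \<le> x" unfolding x_def using n_pos by simp
  finally have l: "?l \<le> 2 * x" using x by simp
  have q: "real q + 2 \<le> 19 / \<epsilon>"
  proof -
    have "2 \<le> 2 / \<epsilon>" using assms(1,3) by (simp add: field_simps)
    then have "real q + 2 \<le> 17 / \<epsilon> + 2 / \<epsilon>" using assms(2) by linarith
    then show ?thesis by (simp add: add_divide_distrib[symmetric])
  qed
  have "real t = 8 * (real c + 3) * real q ^ 2" by (simp add: t_def sample_rate_def)
  also have "\<dots> \<le> 8 * (real c + 3) * (17 / \<epsilon>) ^ 2"
    using assms by (intro mult_left_mono power_mono) auto
  also have "\<dots> = 2312 * (real c + 3) / \<epsilon>\<^sup>2" by (simp add: power_divide)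
  finally have t: "real t \<le> 2312 * (real c + 3) / \<epsilon>\<^sup>2" .
  have "resource_bound \<le> 500 * real n * (2 * x) ^ 3 * (2312 * (real c + 3) / \<epsilon>\<^sup>2) ^ 2 * (19 / \<epsilon>)"
    unfolding resource_bound_def using l q t x
    by (intro mult_mono power_mono) auto
  also have "\<dots> = (76000 * (2312 * (real c + 3))\<^sup>2) * real n * (x ^ 3 / \<epsilon> ^ 5)"
    using assms(1) by (simp add: field_simps eval_nat_numeral)
  also have "\<dots> \<le> (76000 * (2312 * (real c + 3))\<^sup>2) * real n * (x ^ 5 / \<epsilon> ^ 5)"
    using assms(1) x by (intro mult_left_mono divide_right_mono power_increasing) auto
  finally show ?thesis by (simp add: near_linear_def x_def power_divide)
qed

lemma failure_le:
  assumes "n \<ge> 2"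
  shows "real n * (real n * failure) \<le> 1 / real n ^ c"
proof -
  have "exp (- real (floorlog 2 n)) \<le> exp (- ln (real n))" using ln_n_le by simp
  also have "\<dots> = 1 / real n" using n_pos by (simp add: exp_minus inverse_eq_divide)
  finally have "exp (- real (floorlog 2 n)) ^ (c + 3) \<le> (1 / real n) ^ (c + 3)"
    by (rule power_mono) simp
  moreover have "exp (- (real (c + 3) * real (floorlog 2 n))) = exp (- real (floorlog 2 n)) ^ (c + 3)"
    by (metis exp_of_nat_mult mult_minus_right)
  ultimately have "failure \<le> 2 * (1 / real n) ^ (c + 3)" by (simp add: failure_def)
  then have "real n * (real n * failure) \<le> real n * (real n * (2 * (1 / real n) ^ (c + 3)))"
    by (intro mult_left_mono) auto
  also have "\<dots> = (2 / real n) * (1 / real n ^ c)"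
    using n_pos by (simp add: power_add field_simps eval_nat_numeral)
  also have "\<dots> \<le> 1 * (1 / real n ^ c)"
    using assms by (intro mult_right_mono) auto
  finally show ?thesis by simp
qed

lemma charged_init: "charged 1 (init_config n)"
proof -
  have "cells_bits (regs (init_config n)) \<le> 15 * (1 + 2 * floorlog 2 M)"
    using M_ge_affine by (intro cells_bits_le) (auto simp: init_config_def)
  moreover have "cells_bits (mem (init_config n)) = 0"
    by (simp add: init_config_def cells_bits_def)
  ultimately have "occupied (init_config n) \<le> (15 + cells) * (1 + 2 * floorlog 2 M)"
    by (simp add: occupied_def add_mult_distrib)
  then show ?thesis
    using M_ge_affine by (auto simp: charged_def init_config_def occupied_def)
qed

theorem run_densest_prog:
  assumes "16 \<le> \<epsilon> * real q"
  shows "lossless_spmf (run n inc (densest_prog c q))"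
    and "\<And>s. s \<in> set_spmf (run n inc (densest_prog c q)) \<Longrightarrow>
      real (queries s) \<le> resource_bound \<and> real (time s) \<le> resource_bound \<and> real (peak s) \<le> resource_bound"
    and "measure (measure_spmf (run n inc (densest_prog c q))) {s. output_approx_solution (2 + \<epsilon>) n E s}
      \<ge> 1 - 1 / real n ^ c"
proof -
  let ?M = "run n inc (densest_prog c q)"
  obtain S0 where S0: "S0 \<noteq> {}" "S0 \<subseteq> {..<n}" "\<And>v. v \<in> S0 \<Longrightarrow> \<rho> \<le> real (degree_in E S0 v)"
    using obtain_optimum by blast
  let ?ok = "\<lambda>R. \<exists>a b. good S0 {} a b \<and> 0 < b \<and> R 0 = B * a * q \<and> R 1 = b * (2 * (q + 2))"
  have "regs (init_config n) = (\<lambda>_. 0)(0 := n)" "mem (init_config n) = (\<lambda>_. 0)"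
    by (auto simp: init_config_def)
  then have *: "lossless_spmf ?M" "\<And>s. s \<in> set_spmf ?M \<Longrightarrow> \<exists>k. charged k s \<and> real k \<le> total_cost"
    "(\<integral>\<^sup>+s. (if ?ok (regs s) then 0 else 1) \<partial>measure_spmf ?M) \<le> of_nat n * (of_nat n * ennreal failure)"
    using densest_prog_triple[OF S0(2,3)] charged_init unfolding triple_def run_def by auto
  show "lossless_spmf ?M" by (rule *)
  show "real (queries s) \<le> resource_bound \<and> real (time s) \<le> resource_bound \<and> real (peak s) \<le> resource_bound"
    if "s \<in> set_spmf ?M" for s
    using *(2)[OF that] charged_le by blast
  show "measure (measure_spmf ?M) {s. output_approx_solution (2 + \<epsilon>) n E s} \<ge> 1 - 1 / real n ^ c"
  \<comment> \<open>For \<open>n = 1\<close> the claimed probability is 0; \<open>failure_le\<close>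
    starts at 2.\<close>
  proof (cases "n = 1")
    case False
    interpret prob_space "measure_spmf ?M"
      using *(1) by (simp add: lossless_spmf_def weight_spmf_def prob_spaceI measure_spmf.emeasure_eq_measure)
    let ?bad = "{s. \<not> output_approx_solution (2 + \<epsilon>) n E s}"
    have "output_approx_solution (2 + \<epsilon>) n E s" if "?ok (regs s)" for s
      using that good_output[OF _ S0(1) _ assms] by (auto simp: output_approx_solution_def)
    then have "indicator ?bad s \<le> (if ?ok (regs s) then 0 else (1 :: ennreal))" for s
      by (cases "?ok (regs s)") (simp_all add: indicator_def)
    then have "(\<integral>\<^sup>+s. indicator ?bad s \<partial>measure_spmf ?M) \<le>
        (\<integral>\<^sup>+s. (if ?ok (regs s) then 0 else 1) \<partial>measure_spmf ?M)"
      by (rule nn_integral_mono)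
    then have "emeasure (measure_spmf ?M) ?bad \<le> (\<integral>\<^sup>+s. (if ?ok (regs s) then 0 else 1) \<partial>measure_spmf ?M)"
      by (simp only: nn_integral_indicator sets_measure_spmf sets_count_space UNIV_I Pow_UNIV)
    also have "\<dots> \<le> ennreal (real n * (real n * failure))"
      using *(3) by (simp add: ennreal_mult' ennreal_of_nat_eq_real_of_nat failure_def)
    also have "\<dots> \<le> ennreal (1 / real n ^ c)"
      using failure_le False n_pos by (intro ennreal_leI) simp
    finally have "measure (measure_spmf ?M) ?bad \<le> 1 / real n ^ c"
      by (simp add: measure_spmf.emeasure_eq_measure)
    moreover have "measure (measure_spmf ?M) ?bad = 1 - measure (measure_spmf ?M) {s. output_approx_solution (2 + \<epsilon>) n E s}"
      using prob_compl[of "{s. output_approx_solution (2 + \<epsilon>) n E s}"]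
      by (simp add: space_measure_spmf Compl_eq_Diff_UNIV[symmetric] Collect_neg_eq)
    ultimately show ?thesis by simp
  qed simp
qed

end

theorem theorem7p1:
  fixes c :: nat
  shows "\<exists>(C::real) (k::nat). \<forall>\<epsilon>::real. 0 < \<epsilon> \<and> \<epsilon> < 1 \<longrightarrow>
    (\<exists>P::prog. \<forall>(n::nat) (E::nat set set) (inc::nat \<Rightarrow> nat list).
      1 \<le> n \<and> simple_graph n E \<and> incidence_lists n E inc \<longrightarrow>
        lossless_spmf (run n inc P) \<and>
        (\<forall>s \<in> set_spmf (run n inc P).
           real (queries s) \<le> near_linear C k \<epsilon> n \<and>
           real (time s) \<le> near_linear C k \<epsilon> n \<and>
           real (peak s) \<le> near_linear C k \<epsilon> n) \<and>
        measure (measure_spmf (run n inc P)) {s. output_approx_solution (2 + \<epsilon>) n E s}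
          \<ge> 1 - 1 / real n ^ c)"
proof (intro exI allI impI)
  fix \<epsilon> :: real and n :: nat and E inc
  assume \<epsilon>: "0 < \<epsilon> \<and> \<epsilon> < 1"
  \<comment> \<open>16 is what \<open>good_output\<close> asks for; rounding up adds at most 1,
    hence \<open>q <= 17 / \<epsilon>\<close>.\<close>
  define q where "q = nat \<lceil>16 / \<epsilon>\<rceil>"
  assume G: "1 \<le> n \<and> simple_graph n E \<and> incidence_lists n E inc"
  have e: "16 / \<epsilon> > 16" "1 / \<epsilon> \<ge> 1" using \<epsilon> by (auto simp: field_simps)
  have q: "16 / \<epsilon> \<le> real q" "real q \<le> 16 / \<epsilon> + 1" using e unfolding q_def by linarith+
  then have "q \<ge> 17" using e by linarith
  then interpret densest_run n E inc c q
    using G by unfold_locales auto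
  have "16 \<le> \<epsilon> * real q" using q(1) \<epsilon> by (simp add: field_simps)
  note run = run_densest_prog[OF this]
  have "real q \<le> 17 / \<epsilon>" using q(2) e by (simp add: field_simps)
  then have "resource_bound \<le> near_linear (76000 * (2312 * (real c + 3))\<^sup>2) 5 \<epsilon> n"
    using \<epsilon> by (intro resource_bound_le) auto
  \<comment> \<open>This statement fixes the existential witnesses: the program depends on
    \<open>c\<close> and \<open>\<epsilon>\<close> only, the constant factor on \<open>c\<close>
    only.\<close>
  then show "lossless_spmf (run n inc (densest_prog c (nat \<lceil>16 / \<epsilon>\<rceil>))) \<and>
        (\<forall>s \<in> set_spmf (run n inc (densest_prog c (nat \<lceil>16 / \<epsilon>\<rceil>))).
           real (queries s) \<le> near_linear (76000 * (2312 * (real c + 3))\<^sup>2) 5 \<epsilon> n \<and>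
           real (time s) \<le> near_linear (76000 * (2312 * (real c + 3))\<^sup>2) 5 \<epsilon> n \<and>
           real (peak s) \<le> near_linear (76000 * (2312 * (real c + 3))\<^sup>2) 5 \<epsilon> n) \<and>
        measure (measure_spmf (run n inc (densest_prog c (nat \<lceil>16 / \<epsilon>\<rceil>))))
          {s. output_approx_solution (2 + \<epsilon>) n E s} \<ge> 1 - 1 / real n ^ c"
    using run unfolding q_def[symmetric] by (meson order_trans)
qed

end
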